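(* For each $n$ let $U_n$ be a unitary $n\times n$ matrix, with associated Frobenius-optimal (block-diagonal) preconditioning map $P_{U_n}:M_n(\mathbb{C})\to M_n(\mathbb{C})$. Let $\{g_1,\dots,g_m\}$ be a finite set of real-valued continuous $2\pi$-periodic functions such that $P_{U_n}(A_n(f))$ converges to $A_n(f)$ in weak cluster for every $f\in\{g_1,\dots,g_m,g_1^2,\dots,g_m^2\}$. Then $P_{U_n}(A_n(f))$ converges to $A_n(f)$ in weak cluster for every $f$ in the $C^*$-algebra generated by $\{g_1,\dots,g_m\}$.
   Context: Toeplitz matrices: for a continuous $2\pi$-periodic function $f$, $A_n(f)$ is the $n\times n$ matrix with entries $(A_n(f))_{j,k}=a_{j-k}$, where $a_k=\frac1{2\pi}\int_{0}^{2\pi}f(x)e^{-ikx}\,dx$. Preconditioning map: for each $n$ fix pairwise orthogonal orthogonal projections $P_{n_1},\dots,P_{n_{m_n}}$ in $M_n(\mathbb{C})$ with $\sum_{k=1}^{m_n}P_{n_k}=I_n$, and let $\Psi_n(X)=\sum_{k=1}^{m_n}P_{n_k}XP_{n_k}$ (pinching). Let $M_{U_n}=\{X\in M_n(\mathbb{C}): U_n^*XU_n \text{ is block diagonal, i.e. fixed by } \Psi_n\}$, and let $P_{U_n}(X)$ be the element of $M_{U_n}$ closest to $X$ in Frobenius norm; explicitly $P_{U_n}(X)=U_n\Psi_n(U_n^*XU_n)U_n^*$. (The case where the $P_{n_k}$ are the $n$ coordinate projections, so that $\Psi_n$ takes the diagonal part, is included.) Weak cluster: for sequences $\{X_n\},\{Y_n\}$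 of $n\times n$ matrices, $X_n$ converges to $Y_n$ in weak cluster if for every $\epsilon>0$ there exist numbers $N_{1,\epsilon}=N_{1,\epsilon}(n)$ with $N_{1,\epsilon}(n)=o(n)$ as $n\to\infty$ and an integer $N_{2,\epsilon}$ such that for all $n>N_{2,\epsilon}$ all singular values of $X_n-Y_n$ lie in $[0,\epsilon)$ except for at most $N_{1,\epsilon}(n)$ of them (with multiplicity). The $C^*$-algebra is taken inside the algebra of continuous complex-valued $2\pi$-periodic functions with the sup norm. *)

theory Defs
  imports
    "HOL-Analysis.Henstock_Kurzweil_Integration"
    "HOL-Analysis.Uniform_Limit"
    "HOL-Library.Landau_Symbols"
    "Jordan_Normal_Form.Schur_Decomposition"
begin

section \<open>Matrices\<close>

definition unitary_mat :: "nat \<Rightarrow> complex mat \<Rightarrow> bool" where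
  "unitary_mat n U \<longleftrightarrow> U \<in> carrier_mat n n \<and> mat_adjoint U * U = 1\<^sub>m n \<and> U * mat_adjoint U = 1\<^sub>m n"

definition orth_projection :: "nat \<Rightarrow> complex mat \<Rightarrow> bool" where
  "orth_projection n Q \<longleftrightarrow> Q \<in> carrier_mat n n \<and> mat_adjoint Q = Q \<and> Q * Q = Q"

text \<open>Matrices of all sizes form one type, which therefore has no zero matrix and no
  \<^const>\<open>sum\<close>; the size is passed explicitly.\<close>

definition sum_mats :: "nat \<Rightarrow> (nat \<Rightarrow> complex mat) \<Rightarrow> nat set \<Rightarrow> complex mat" where
  "sum_mats n F I = mat n n (\<lambda>(i, j). \<Sum>k\<in>I. F k $$ (i, j))"

definition frobenius_norm :: "complex mat \<Rightarrow> real" where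
  "frobenius_norm A = sqrt (\<Sum>i<dim_row A. \<Sum>j<dim_col A. (cmod (A $$ (i, j)))\<^sup>2)"

text \<open>The eigenvalues of \<open>A\<^sup>*A\<close> are real and nonnegative, so \<^const>\<open>Re\<close> loses nothing; they are
  counted with their multiplicity as roots of the characteristic polynomial.\<close>

definition singular_values :: "complex mat \<Rightarrow> real multiset" where
  "singular_values A = image_mset (\<lambda>z. sqrt (Re z)) (proots (char_poly (mat_adjoint A * A)))"


section \<open>The preconditioning map\<close>

definition projection_family :: "nat \<Rightarrow> nat \<Rightarrow> (nat \<Rightarrow> complex mat) \<Rightarrow> bool" where
  "projection_family n m P \<longleftrightarrow>
     (\<forall>k\<in>{1..m}. orth_projection n (P k)) \<and>
     (\<forall>j\<in>{1..m}. \<forall>k\<in>{1..m}. j \<noteq> k \<longrightarrow> P j * P k = 0\<^sub>m n n) \<and>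
     sum_mats n P {1..m} = 1\<^sub>m n"

definition pinching :: "nat \<Rightarrow> nat \<Rightarrow> (nat \<Rightarrow> complex mat) \<Rightarrow> complex mat \<Rightarrow> complex mat" where
  "pinching n m P X = sum_mats n (\<lambda>k. P k * X * P k) {1..m}"

definition block_diagonal_space ::
    "nat \<Rightarrow> nat \<Rightarrow> (nat \<Rightarrow> complex mat) \<Rightarrow> complex mat \<Rightarrow> complex mat set" where
  "block_diagonal_space n m P U =
     {X \<in> carrier_mat n n. pinching n m P (mat_adjoint U * X * U) = mat_adjoint U * X * U}"

text \<open>The minimiser exists and is unique; see \<open>precond_eq\<close> below for the explicit formula.\<close>

definition precond ::
    "nat \<Rightarrow> nat \<Rightarrow> (nat \<Rightarrow> complex mat) \<Rightarrow> complex mat \<Rightarrow> complex mat \<Rightarrow> complex mat" where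
  "precond n m P U X =
     (THE Y. is_arg_min (\<lambda>Y. frobenius_norm (X - Y)) (\<lambda>Y. Y \<in> block_diagonal_space n m P U) Y)"


section \<open>Toeplitz matrices and weak clusters\<close>

definition fourier_coeff :: "(real \<Rightarrow> complex) \<Rightarrow> int \<Rightarrow> complex" where
  "fourier_coeff f k =
     1 / (2 * of_real pi) * integral {0..2 * pi} (\<lambda>x. f x * exp (- \<i> * of_int k * of_real x))"

definition toeplitz :: "(real \<Rightarrow> complex) \<Rightarrow> nat \<Rightarrow> complex mat" where
  "toeplitz f n = mat n n (\<lambda>(j, k). fourier_coeff f (int j - int k))"

definition weak_cluster :: "(nat \<Rightarrow> complex mat) \<Rightarrow> (nat \<Rightarrow> complex mat) \<Rightarrow> bool" where
  "weak_cluster X Y \<longleftrightarrow>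
     (\<forall>\<epsilon>>0. \<exists>(N1 :: nat \<Rightarrow> nat) (N2 :: nat).
        (\<lambda>n. real (N1 n)) \<in> o(\<lambda>n. real n) \<and>
        (\<forall>n>N2. size (filter_mset (\<lambda>s. s \<notin> {0..<\<epsilon>}) (singular_values (X n - Y n))) \<le> N1 n))"


section \<open>Generated C*-algebras of periodic functions\<close>

definition cont_periodic :: "(real \<Rightarrow> complex) set" where
  "cont_periodic = {f. continuous_on UNIV f \<and> (\<forall>x. f (x + 2 * pi) = f x)}"

text \<open>C*-subalgebras are taken with the unit of \<^const>\<open>cont_periodic\<close>, so the algebra generated
  by a set contains the one generated without the unit. Uniform limits on the whole line
  are limits in the sup norm.\<close>

definition cstar_subalgebra :: "(real \<Rightarrow> complex) set \<Rightarrow> bool" where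
  "cstar_subalgebra A \<longleftrightarrow>
     A \<subseteq> cont_periodic \<and>
     (\<lambda>x. 1) \<in> A \<and>
     (\<forall>f\<in>A. \<forall>g\<in>A. (\<lambda>x. f x + g x) \<in> A) \<and>
     (\<forall>c. \<forall>f\<in>A. (\<lambda>x. c * f x) \<in> A) \<and>
     (\<forall>f\<in>A. \<forall>g\<in>A. (\<lambda>x. f x * g x) \<in> A) \<and>
     (\<forall>f\<in>A. (\<lambda>x. cnj (f x)) \<in> A) \<and>
     (\<forall>F f. (\<forall>n. F n \<in> A) \<and> uniform_limit UNIV F f sequentially \<longrightarrow> f \<in> A)"

definition cstar_generated :: "(real \<Rightarrow> complex) set \<Rightarrow> (real \<Rightarrow> complex) set" where
  "cstar_generated S = \<Inter>{A. cstar_subalgebra A \<and> S \<subseteq> A}"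


section \<open>The explicit formula for the preconditioning map\<close>

lemma mat_adjoint_carrier:
  "A \<in> carrier_mat n k \<Longrightarrow> mat_adjoint A \<in> carrier_mat k n"
  by (auto simp: mat_adjoint_def mat_of_rows_def)

lemma index_mat_adjoint:
  "A \<in> carrier_mat n k \<Longrightarrow> i < k \<Longrightarrow> j < n \<Longrightarrow> mat_adjoint A $$ (i, j) = cnj (A $$ (j, i :: nat))"
  by (auto simp: mat_adjoint_def mat_of_rows_def)

lemma mat_adjoint_involutive:
  "A \<in> carrier_mat n k \<Longrightarrow> mat_adjoint (mat_adjoint A) = (A :: complex mat)"
  by (rule eq_matI)
    (use mat_adjoint_carrier[of A n k] mat_adjoint_carrier[of "mat_adjoint A" k n] in
      \<open>auto simp: index_mat_adjoint\<close>)

lemma sum_mats_carrier [simp]: "sum_mats n F I \<in> carrier_mat n n"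
  by (simp add: sum_mats_def)

lemma mult_entry:
  "A \<in> carrier_mat n n \<Longrightarrow> B \<in> carrier_mat n n \<Longrightarrow> i < n \<Longrightarrow> j < n \<Longrightarrow>
    (A * B) $$ (i, j) = (\<Sum>l<n. A $$ (i, l) * B $$ (l, j :: nat))"
  by (auto simp: scalar_prod_def atLeast0LessThan)

lemma mult_sum_mats:
  fixes A :: "complex mat"
  assumes "A \<in> carrier_mat n n" "\<And>k. k \<in> I \<Longrightarrow> F k \<in> carrier_mat n n"
  shows "A * sum_mats n F I = sum_mats n (\<lambda>k. A * F k) I"
proof (rule eq_matI)
  fix i j assume "i < dim_row (sum_mats n (\<lambda>k. A * F k) I)" "j < dim_col (sum_mats n (\<lambda>k. A * F k) I)"
  hence ij: "i < n" "j < n" by (auto simp: sum_mats_def)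
  have "(A * sum_mats n F I) $$ (i, j) = (\<Sum>l<n. \<Sum>k\<in>I. A $$ (i, l) * F k $$ (l, j))"
    by (subst mult_entry[OF assms(1) sum_mats_carrier ij]) (use ij in \<open>simp add: sum_mats_def sum_distrib_left\<close>)
  also have "\<dots> = (\<Sum>k\<in>I. \<Sum>l<n. A $$ (i, l) * F k $$ (l, j))" by (rule sum.swap)
  also have "\<dots> = sum_mats n (\<lambda>k. A * F k) I $$ (i, j)"
    using ij assms by (auto simp: sum_mats_def mult_entry[of _ n] simp del: index_mult_mat intro!: sum.cong)
  finally show "(A * sum_mats n F I) $$ (i, j) = sum_mats n (\<lambda>k. A * F k) I $$ (i, j)" .
qed (use assms in \<open>auto simp: sum_mats_def\<close>)

lemma sum_mats_mult:
  fixes A :: "complex mat"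
  assumes "A \<in> carrier_mat n n" "\<And>k. k \<in> I \<Longrightarrow> F k \<in> carrier_mat n n"
  shows "sum_mats n F I * A = sum_mats n (\<lambda>k. F k * A) I"
proof (rule eq_matI)
  fix i j assume "i < dim_row (sum_mats n (\<lambda>k. F k * A) I)" "j < dim_col (sum_mats n (\<lambda>k. F k * A) I)"
  hence ij: "i < n" "j < n" by (auto simp: sum_mats_def)
  have "(sum_mats n F I * A) $$ (i, j) = (\<Sum>l<n. \<Sum>k\<in>I. F k $$ (i, l) * A $$ (l, j))"
    by (subst mult_entry[OF sum_mats_carrier assms(1) ij]) (use ij in \<open>simp add: sum_mats_def sum_distrib_right\<close>)
  also have "\<dots> = (\<Sum>k\<in>I. \<Sum>l<n. F k $$ (i, l) * A $$ (l, j))" by (rule sum.swap)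
  also have "\<dots> = sum_mats n (\<lambda>k. F k * A) I $$ (i, j)"
    using ij assms by (auto simp: sum_mats_def mult_entry[of _ n] simp del: index_mult_mat intro!: sum.cong)
  finally show "(sum_mats n F I * A) $$ (i, j) = sum_mats n (\<lambda>k. F k * A) I $$ (i, j)" .
qed (use assms in \<open>auto simp: sum_mats_def\<close>)

lemma sum_mats_cong:
  "(\<And>k. k \<in> I \<Longrightarrow> F k = G k) \<Longrightarrow> sum_mats n F I = sum_mats n G I"
  by (auto simp: sum_mats_def intro!: sum.cong arg_cong[of _ _ "mat n n"])

lemma sum_mats_delta:
  assumes "finite I" "k \<in> I" "B \<in> carrier_mat n n"
  shows "sum_mats n (\<lambda>j. if j = k then B else 0\<^sub>m n n) I = B"
proof (rule eq_matI)
  fix i j assume "i < dim_row B" "j < dim_col B"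
  hence "i < n" "j < n" using assms by auto
  hence "sum_mats n (\<lambda>j. if j = k then B else 0\<^sub>m n n) I $$ (i, j)
     = (\<Sum>l\<in>I. if l = k then B $$ (i, j) else 0)"
    by (auto simp: sum_mats_def intro!: sum.cong)
  thus "sum_mats n (\<lambda>j. if j = k then B else 0\<^sub>m n n) I $$ (i, j) = B $$ (i, j)" using assms by simp
qed (use assms in \<open>auto simp: sum_mats_def\<close>)

lemma pinching_carrier [simp]: "pinching n m P X \<in> carrier_mat n n"
  by (simp add: pinching_def)

lemma pinching_idem:
  assumes "projection_family n m P" "X \<in> carrier_mat n n"
  shows "pinching n m P (pinching n m P X) = pinching n m P X"
proof -
  have P: "P k \<in> carrier_mat n n" "P k * P k = P k" if "k \<in> {1..m}" for k
    using assms that by (auto simp: projection_family_def orth_projection_def)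
  have O: "P j * P k = 0\<^sub>m n n" if "k \<in> {1..m}" "j \<in> {1..m}" "j \<noteq> k" for j k
    using assms that by (auto simp: projection_family_def)
  have "P k * pinching n m P X * P k = P k * X * P k" if k: "k \<in> {1..m}" for k
  proof -
    have C: "P j * X * P j \<in> carrier_mat n n" if "j \<in> {1..m}" for j
      using P that assms by (intro mult_carrier_mat[of _ n n]) auto
    have "P k * pinching n m P X * P k = sum_mats n (\<lambda>j. P k * (P j * X * P j) * P k) {1..m}"
      using P[OF k] C unfolding pinching_def
      by (subst mult_sum_mats, (auto)[2], subst sum_mats_mult) auto
    also have "\<dots> = sum_mats n (\<lambda>j. if j = k then P k * X * P k else 0\<^sub>m n n) {1..m}"
    proof (rule sum_mats_cong)
      fix j assume j: "j \<in> {1..m}"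
      have "P k * (P j * X * P j) * P k = (P k * P j) * X * (P j * P k)"
        using P[OF k] P[OF j] assms by (simp add: assoc_mult_mat[of _ n n _ n _ n])
      also have "\<dots> = (if j = k then P k * X * P k else 0\<^sub>m n n)"
      proof (cases "j = k")
        case True
        thus ?thesis using P(2)[OF k] by (simp only: if_True simp_thms)
      next
        case False
        hence "P k * P j = 0\<^sub>m n n" "P j * P k = 0\<^sub>m n n" using O[OF j k] O[OF k j] by auto
        thus ?thesis using False assms(2) by simp
      qed
      finally show "P k * (P j * X * P j) * P k = (if j = k then P k * X * P k else 0\<^sub>m n n)" .
    qed
    also have "\<dots> = P k * X * P k" using k C by (intro sum_mats_delta) auto
    finally show ?thesis .
  qed
  hence "sum_mats n (\<lambda>k. P k * pinching n m P X * P k) {1..m} = sum_mats n (\<lambda>k. P k * X * P k) {1..m}"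
    by (rule sum_mats_cong)
  thus ?thesis by (simp only: pinching_def)
qed

definition fip :: "nat \<Rightarrow> complex mat \<Rightarrow> complex mat \<Rightarrow> complex" where
  "fip n A B = (\<Sum>i<n. \<Sum>j<n. cnj (A $$ (i, j)) * B $$ (i, j))"

lemma fip_mult_left:
  assumes "A \<in> carrier_mat n n" "B \<in> carrier_mat n n" "C \<in> carrier_mat n n"
  shows "fip n (A * B) C = fip n B (mat_adjoint A * C)"
proof -
  have "fip n (A * B) C = (\<Sum>i<n. \<Sum>j<n. \<Sum>l<n. cnj (A $$ (i, l)) * cnj (B $$ (l, j)) * C $$ (i, j))"
    unfolding fip_def using assms
    by (auto simp: mult_entry sum_distrib_right simp del: index_mult_mat intro!: sum.cong)
  also have "\<dots> = (\<Sum>l<n. \<Sum>j<n. \<Sum>i<n. cnj (A $$ (i, l)) * cnj (B $$ (l, j)) * C $$ (i, j))"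
    by (subst sum.swap, subst (2) sum.swap, subst sum.swap) (rule refl)
  also have "\<dots> = fip n B (mat_adjoint A * C)"
    unfolding fip_def using assms mat_adjoint_carrier[OF assms(1)]
    by (auto simp: mult_entry index_mat_adjoint sum_distrib_left mult_ac simp del: index_mult_mat intro!: sum.cong)
  finally show ?thesis .
qed

lemma fip_mult_right:
  assumes "A \<in> carrier_mat n n" "B \<in> carrier_mat n n" "C \<in> carrier_mat n n"
  shows "fip n (A * B) C = fip n A (C * mat_adjoint B)"
proof -
  have "fip n (A * B) C = (\<Sum>i<n. \<Sum>j<n. \<Sum>l<n. cnj (A $$ (i, l)) * cnj (B $$ (l, j)) * C $$ (i, j))"
    unfolding fip_def using assms
    by (auto simp: mult_entry sum_distrib_right simp del: index_mult_mat intro!: sum.cong)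
  also have "\<dots> = (\<Sum>i<n. \<Sum>l<n. \<Sum>j<n. cnj (A $$ (i, l)) * cnj (B $$ (l, j)) * C $$ (i, j))"
    by (subst (2) sum.swap) (rule refl)
  also have "\<dots> = fip n A (C * mat_adjoint B)"
    unfolding fip_def using assms mat_adjoint_carrier[OF assms(2)]
    by (auto simp: mult_entry index_mat_adjoint sum_distrib_left mult_ac simp del: index_mult_mat intro!: sum.cong)
  finally show ?thesis .
qed

lemma fip_sum_mats_left: "fip n (sum_mats n F I) B = (\<Sum>k\<in>I. fip n (F k) B)"
proof -
  have "fip n (sum_mats n F I) B = (\<Sum>i<n. \<Sum>j<n. \<Sum>k\<in>I. cnj (F k $$ (i, j)) * B $$ (i, j))"
    by (simp add: fip_def sum_mats_def sum_distrib_right)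
  also have "\<dots> = (\<Sum>i<n. \<Sum>k\<in>I. \<Sum>j<n. cnj (F k $$ (i, j)) * B $$ (i, j))"
    by (subst (2) sum.swap) (rule refl)
  also have "\<dots> = (\<Sum>k\<in>I. \<Sum>i<n. \<Sum>j<n. cnj (F k $$ (i, j)) * B $$ (i, j))"
    by (rule sum.swap)
  finally show ?thesis by (simp add: fip_def)
qed

lemma fip_cnj: "fip n A B = cnj (fip n B A)"
  by (simp add: fip_def mult.commute)

lemma fip_sum_mats_right: "fip n A (sum_mats n F I) = (\<Sum>k\<in>I. fip n A (F k))"
  by (subst fip_cnj, subst fip_sum_mats_left, subst cnj_sum, rule sum.cong, rule refl, subst (2) fip_cnj, rule refl)

lemma fip_minus_right:
  "B \<in> carrier_mat n n \<Longrightarrow> C \<in> carrier_mat n n \<Longrightarrow> fip n A (B - C) = fip n A B - fip n A C"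
  by (simp add: fip_def ring_distribs sum_subtractf)

lemma fip_pinching:
  assumes "projection_family n m P" "A \<in> carrier_mat n n" "B \<in> carrier_mat n n"
  shows "fip n (pinching n m P A) B = fip n A (pinching n m P B)"
  unfolding pinching_def fip_sum_mats_left fip_sum_mats_right
proof (rule sum.cong)
  fix k assume "k \<in> {1..m}"
  hence P: "P k \<in> carrier_mat n n" "mat_adjoint (P k) = P k"
    using assms by (auto simp: projection_family_def orth_projection_def)
  have "fip n (P k * A * P k) B = fip n (P k * A) (B * P k)"
    using fip_mult_right[of "P k * A" n "P k" B] P assms by simp
  also have "\<dots> = fip n A (P k * (B * P k))"
    using fip_mult_left[of "P k" n A "B * P k"] P assms by simp
  finally show "fip n (P k * A * P k) B = fip n A (P k * B * P k)"
    using P assms by (simp add: assoc_mult_mat[of _ n n _ n _ n])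
qed simp

lemma frobenius_norm_fip:
  "A \<in> carrier_mat n n \<Longrightarrow> (frobenius_norm A)\<^sup>2 = Re (fip n A A)"
proof -
  have "fip n A A = complex_of_real (\<Sum>i<n. \<Sum>j<n. (cmod (A $$ (i, j)))\<^sup>2)"
    unfolding fip_def of_real_sum complex_norm_square by (simp add: mult.commute)
  hence "Re (fip n A A) = (\<Sum>i<n. \<Sum>j<n. (cmod (A $$ (i, j)))\<^sup>2)" by simp
  moreover have "(\<Sum>i<n. \<Sum>j<n. (cmod (A $$ (i, j)))\<^sup>2) \<ge> 0" by (intro sum_nonneg) simp
  moreover assume "A \<in> carrier_mat n n"
  ultimately show ?thesis by (simp add: frobenius_norm_def)
qed

lemma frobenius_norm_nonneg: "frobenius_norm A \<ge> 0"
  by (auto simp: frobenius_norm_def intro!: sum_nonneg)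

lemma frobenius_norm_zero_imp:
  assumes "A \<in> carrier_mat n n" "frobenius_norm A = 0"
  shows "A = 0\<^sub>m n n"
proof (rule eq_matI)
  fix i j assume "i < dim_row (0\<^sub>m n n :: complex mat)" "j < dim_col (0\<^sub>m n n :: complex mat)"
  thus "A $$ (i, j) = 0\<^sub>m n n $$ (i, j)"
    using assms by (auto simp: frobenius_norm_def sum_nonneg_eq_0_iff sum_nonneg)
qed (use assms in auto)

lemma pinching_minus:
  assumes "projection_family n m P" "A \<in> carrier_mat n n" "B \<in> carrier_mat n n"
  shows "pinching n m P (A - B) = pinching n m P A - pinching n m P B"
proof (rule eq_matI)
  fix i j assume "i < dim_row (pinching n m P A - pinching n m P B)" "j < dim_col (pinching n m P A - pinching n m P B)"
  hence ij: "i < n" "j < n" by (auto simp: pinching_def sum_mats_def)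
  have "P k * (A - B) * P k = P k * A * P k - P k * B * P k" if "k \<in> {1..m}" for k
  proof -
    have "P k \<in> carrier_mat n n" using that assms by (auto simp: projection_family_def orth_projection_def)
    thus ?thesis using assms
      by (simp add: minus_mult_distrib_mat[of _ n n _ _ n] mult_minus_distrib_mat[of _ n n _ n])
  qed
  moreover have "dim_row (P k) = n" "dim_col (P k) = n" if "k \<in> {1..m}" for k
    using that assms by (auto simp: projection_family_def orth_projection_def)
  ultimately show "pinching n m P (A - B) $$ (i, j) = (pinching n m P A - pinching n m P B) $$ (i, j)"
    using ij by (simp add: pinching_def sum_mats_def sum_subtractf del: index_mult_mat(1))
qed (auto simp: pinching_def sum_mats_def)

theorem precond_eq:
  assumes U: "unitary_mat n U" and P: "projection_family n m P" and X: "X \<in> carrier_mat n n"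
  shows "precond n m P U X = U * pinching n m P (mat_adjoint U * X * U) * mat_adjoint U"
proof -
  define V where "V = mat_adjoint U"
  define Q where "Q = (\<lambda>X. U * pinching n m P (V * X * U) * V)"
  have UV [simp]: "U \<in> carrier_mat n n" "V \<in> carrier_mat n n" "U * V = 1\<^sub>m n" "V * U = 1\<^sub>m n"
    and adj: "mat_adjoint U = V" "mat_adjoint V = U"
    using U mat_adjoint_carrier[of U n n] mat_adjoint_involutive[of U n n]
    by (auto simp: unitary_mat_def V_def)
  note ass = assoc_mult_mat[of _ n n _ n _ n]
  have Qc [simp]: "Q Y \<in> carrier_mat n n" for Y
    by (auto simp: Q_def intro!: mult_carrier_mat[of _ n n])
  have cancel: "V * (U * B) = B" "U * (V * B) = B" if "B \<in> carrier_mat n n" for B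
    using ass[of V U B] ass[of U V B] that by auto
  have cancel': "(B * U) * V = B" "(B * V) * U = B" if "B \<in> carrier_mat n n" for B
    using ass[of B U V] ass[of B V U] that by auto
  have VQU: "V * Q Y * U = pinching n m P (V * Y * U)" if "Y \<in> carrier_mat n n" for Y
  proof -
    have "V * Q Y * U = V * (U * (pinching n m P (V * Y * U) * V)) * U"
      by (simp add: Q_def ass)
    also have "\<dots> = pinching n m P (V * Y * U)"
      by (simp add: cancel cancel' mult_carrier_mat[of _ n n])
    finally show ?thesis .
  qed
  have mem: "Q Y \<in> block_diagonal_space n m P U" if "Y \<in> carrier_mat n n" for Y
    using VQU[OF that] pinching_idem[OF P, of "V * Y * U"] that
    by (simp add: block_diagonal_space_def adj mult_carrier_mat[of _ n n])
  have fixd: "Z \<in> carrier_mat n n" "Q Z = Z" if "Z \<in> block_diagonal_space n m P U" for Z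
  proof -
    show Z: "Z \<in> carrier_mat n n" using that by (simp add: block_diagonal_space_def)
    have "Q Z = U * (V * Z * U) * V" using that by (simp add: block_diagonal_space_def adj Q_def)
    also have "\<dots> = U * (V * (Z * U)) * V" using Z by (simp add: ass)
    also have "\<dots> = Z" using Z by (simp add: cancel cancel' mult_carrier_mat[of _ n n])
    finally show "Q Z = Z" .
  qed
  have selfadj: "fip n (Q A) B = fip n A (Q B)" if "A \<in> carrier_mat n n" "B \<in> carrier_mat n n" for A B
  proof -
    let ?D = "pinching n m P (V * A * U)"
    have "fip n (Q A) B = fip n (U * ?D) (B * U)"
      unfolding Q_def using fip_mult_right[of "U * ?D" n V B] that adj by (simp add: mult_carrier_mat[of _ n n])
    also have "\<dots> = fip n ?D (V * (B * U))"
      using fip_mult_left[of U n ?D "B * U"] that adj by (simp add: mult_carrier_mat[of _ n n])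
    also have "\<dots> = fip n (V * A * U) (pinching n m P (V * (B * U)))"
      using that by (intro fip_pinching[OF P]) (auto simp: mult_carrier_mat[of _ n n])
    also have "\<dots> = fip n (V * A) (pinching n m P (V * B * U) * V)"
      using fip_mult_right[of "V * A" n U "pinching n m P (V * (B * U))"] that adj
      by (simp add: mult_carrier_mat[of _ n n] ass)
    also have "\<dots> = fip n A (U * (pinching n m P (V * B * U) * V))"
      using fip_mult_left[of V n A "pinching n m P (V * B * U) * V"] that adj
      by (simp add: mult_carrier_mat[of _ n n])
    also have "\<dots> = fip n A (Q B)" by (simp add: Q_def ass)
    finally show ?thesis .
  qed
  let ?M = "block_diagonal_space n m P U"
  have pyth: "(frobenius_norm (X - Z))\<^sup>2 = (frobenius_norm (X - Q X))\<^sup>2 + (frobenius_norm (Q X - Z))\<^sup>2"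
    if Z: "Z \<in> ?M" for Z
  proof -
    note Zc = fixd[OF Z]
    have QQ: "Q (Q X) = Q X" using fixd(2)[OF mem[OF X]] .
    have min: "fip n (A - B) C = fip n A C - fip n B C" if "A \<in> carrier_mat n n" "B \<in> carrier_mat n n" for A B C
      using that by (simp add: fip_def ring_distribs sum_subtractf)
    have r: "fip n (X - Q X) Y = 0" if "Y \<in> ?M" for Y
    proof -
      note Yc = fixd[OF that]
      have "fip n (Q X) Y = fip n X Y" using selfadj[OF X Yc(1)] Yc by simp
      thus ?thesis using X Yc by (simp add: min)
    qed
    define W where "W = Q X - Z"
    define R where "R = X - Q X"
    have c: "W \<in> carrier_mat n n" "R \<in> carrier_mat n n" using X Zc by (auto simp: W_def R_def intro!: minus_carrier_mat Qc)
    have RW: "fip n R W = 0"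
      using r[OF Z] r[OF mem[OF X]] Zc by (simp add: R_def W_def fip_minus_right)
    have WR: "fip n W R = 0" using RW fip_cnj[of n W R] by simp
    have "X - Z = R + W" using X Zc carrier_matD[OF Qc[of X]] by (intro eq_matI) (auto simp: R_def W_def)
    moreover have "fip n (R + W) (R + W) = fip n R R + fip n R W + fip n W R + fip n W W"
      using c by (simp add: fip_def ring_distribs sum.distrib)
    ultimately show ?thesis using c RW WR
      by (simp add: frobenius_norm_fip[of _ n] flip: R_def W_def)
  qed
  have "precond n m P U X = Q X"
    unfolding precond_def
  proof (rule the_equality)
    show "is_arg_min (\<lambda>Y. frobenius_norm (X - Y)) (\<lambda>Y. Y \<in> ?M) (Q X)"
      unfolding is_arg_min_linorder
    proof (intro conjI allI impI mem[OF X])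
      fix Z assume "Z \<in> ?M"
      from pyth[OF this] show "frobenius_norm (X - Q X) \<le> frobenius_norm (X - Z)"
        by (intro power2_le_imp_le[OF _ frobenius_norm_nonneg]) simp
    qed
  next
    fix Z assume a: "is_arg_min (\<lambda>Y. frobenius_norm (X - Y)) (\<lambda>Y. Y \<in> ?M) Z"
    hence Z: "Z \<in> ?M" and "frobenius_norm (X - Z) \<le> frobenius_norm (X - Q X)"
      using mem[OF X] by (auto simp: is_arg_min_linorder)
    hence "(frobenius_norm (X - Z))\<^sup>2 \<le> (frobenius_norm (X - Q X))\<^sup>2"
      by (intro power_mono frobenius_norm_nonneg)
    hence "frobenius_norm (Q X - Z) = 0" using pyth[OF Z] zero_le_power2[of "frobenius_norm (Q X - Z)"] by simp
    hence e: "Q X - Z = 0\<^sub>m n n" using fixd[OF Z] by (intro frobenius_norm_zero_imp) auto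
    show "Z = Q X"
    proof (rule eq_matI)
      fix i j assume ij: "i < dim_row (Q X)" "j < dim_col (Q X)"
      hence ij: "i < n" "j < n" using Qc[of X] by auto
      hence "(Q X - Z) $$ (i, j) = 0" using e by simp
      thus "Z $$ (i, j) = Q X $$ (i, j)" using ij fixd[OF Z] by auto
    qed (use fixd[OF Z] carrier_matD[OF Qc[of X]] in auto)
  qed
  thus ?thesis by (simp add: Q_def V_def)
qed

end

theory Submission
  imports
    Defs
    "HOL-Analysis.Weierstrass_Theorems"
    "HOL-Analysis.Complex_Transcendental"
    "HOL-Real_Asymp.Real_Asymp"
begin

text \<open>
  After conjugating the projections by \<open>U\<^sub>n\<close>, the preconditioner is a pinching \<open>E\<^sub>n\<close>: the conditional
  expectation of \<open>M\<^sub>n(\<complex>)\<close> onto the *-algebra of matrices that commute with a family of projections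
  (\<open>precond_eq_pinching\<close>). It is the Frobenius-orthogonal projection onto that algebra, it commutes
  with the adjoint, and it does not increase the operator norm.

  The sum of the squares of the singular values is the squared Frobenius norm. Hence, for sequences
  that are bounded in operator norm, a weak cluster at zero is the same as \<open>\<parallel>X\<^sub>n\<parallel>\<^sub>F = o(\<surd>n)\<close>: outliers
  are few because each of them costs at least \<open>\<epsilon>\<^sup>2\<close>, and conversely few bounded outliers contribute
  only \<open>o(n)\<close>. Toeplitz matrices of a bounded symbol are bounded in operator norm by the sup norm of
  the symbol (\<open>toeplitz_mult_bounded\<close>), so for continuous \<open>f\<close> the conclusion reads
  \<open>\<parallel>A\<^sub>n(f) - E\<^sub>n(A\<^sub>n(f))\<parallel>\<^sub>F = o(\<surd>n)\<close>: up to \<open>o(\<surd>n)\<close>, the matrix \<open>A\<^sub>n(f)\<close> lies in the range of \<open>E\<^sub>n\<close>.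

  The symbols with this property form a C*-algebra, and this gives the theorem. The range of \<open>E\<^sub>n\<close> is a
  *-algebra, so everything follows once \<open>f \<mapsto> A\<^sub>n(f)\<close> is a *-homomorphism up to \<open>o(\<surd>n)\<close>. Only
  the product needs work. If \<open>g\<close> is a monomial \<open>e\<^sup>i\<^sup>k\<^sup>x\<close>, then \<open>A\<^sub>n(f g) - A\<^sub>n(f) A\<^sub>n(g)\<close> has at most \<open>\<bar>k\<bar>\<close>
  nonzero columns, each of bounded norm; trigonometric polynomials are uniformly dense by the
  Stone-Weierstrass theorem on the unit circle, and both sides depend on \<open>g\<close> continuously at the scale
  \<open>\<surd>n\<close> (\<open>toeplitz_mult_asymptotic\<close>). For the product of two symbols in the algebra, the matrix
  \<open>E\<^sub>n(A\<^sub>n(f)) E\<^sub>n(A\<^sub>n(g))\<close> is block diagonal and close to \<open>A\<^sub>n(f g)\<close>, and \<open>E\<^sub>n(A\<^sub>n(f g))\<close> is at least as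
  close, being the best approximation.
\<close>

section \<open>The Frobenius norm, adjoints and operator bounds\<close>

lemma frobenius_norm_sq:
  assumes "A \<in> carrier_mat n n"
  shows "(frobenius_norm A)\<^sup>2 = (\<Sum>i<n. \<Sum>j<n. (cmod (A $$ (i, j)))\<^sup>2)"
  using assms by (auto simp: frobenius_norm_def intro!: real_sqrt_pow2 sum_nonneg)

lemma frobenius_norm_L2_set:
  assumes "A \<in> carrier_mat n n"
  shows "frobenius_norm A = L2_set (\<lambda>(i, j). cmod (A $$ (i, j))) ({..<n} \<times> {..<n})"
  using assms by (simp add: frobenius_norm_def L2_set_def sum.cartesian_product split_def)

lemma frobenius_norm_triangle:
  assumes "A \<in> carrier_mat n n" "B \<in> carrier_mat n n"
  shows "frobenius_norm (A + B) \<le> frobenius_norm A + frobenius_norm B"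
proof -
  have "frobenius_norm (A + B) = L2_set (\<lambda>(i, j). cmod ((A + B) $$ (i, j))) ({..<n} \<times> {..<n})"
    using assms by (intro frobenius_norm_L2_set) auto
  also have "\<dots> \<le> L2_set (\<lambda>p. (\<lambda>(i, j). cmod (A $$ (i, j))) p + (\<lambda>(i, j). cmod (B $$ (i, j))) p)
      ({..<n} \<times> {..<n})"
    using assms by (intro L2_set_mono) (auto intro: norm_triangle_ineq)
  also have "\<dots> \<le> frobenius_norm A + frobenius_norm B"
    unfolding frobenius_norm_L2_set[OF assms(1)] frobenius_norm_L2_set[OF assms(2)]
    by (rule L2_set_triangle_ineq)
  finally show ?thesis .
qed

lemma frobenius_norm_smult: "frobenius_norm (c \<cdot>\<^sub>m A) = cmod c * frobenius_norm A"
proof -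
  have "(\<Sum>i<dim_row A. \<Sum>j<dim_col A. (cmod ((c \<cdot>\<^sub>m A) $$ (i, j)))\<^sup>2)
      = (cmod c)\<^sup>2 * (\<Sum>i<dim_row A. \<Sum>j<dim_col A. (cmod (A $$ (i, j)))\<^sup>2)"
    by (simp add: norm_mult power_mult_distrib sum_distrib_left)
  thus ?thesis by (simp add: frobenius_norm_def real_sqrt_mult)
qed

lemma frobenius_norm_minus_commute:
  assumes "A \<in> carrier_mat n n" "B \<in> carrier_mat n n"
  shows "frobenius_norm (A - B) = frobenius_norm (B - A)"
  using assms by (auto simp: frobenius_norm_def norm_minus_commute)

lemma frobenius_norm_diff_le:
  assumes "A \<in> carrier_mat n n" "B \<in> carrier_mat n n"
  shows "frobenius_norm (A - B) \<le> frobenius_norm A + frobenius_norm B"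
proof -
  have "A - B = A + (- 1) \<cdot>\<^sub>m B" using assms by (intro eq_matI) auto
  thus ?thesis using frobenius_norm_triangle[of A n "(- 1) \<cdot>\<^sub>m B"] assms
    by (simp add: frobenius_norm_smult)
qed

lemma frobenius_norm_triangle_minus:
  assumes "A \<in> carrier_mat n n" "B \<in> carrier_mat n n" "C \<in> carrier_mat n n"
  shows "frobenius_norm (A - C) \<le> frobenius_norm (A - B) + frobenius_norm (B - C)"
proof -
  have "A - C = (A - B) + (B - C)" using assms by (intro eq_matI) auto
  thus ?thesis
    using frobenius_norm_triangle[of "A - B" n "B - C"] assms by (simp add: minus_carrier_mat)
qed

lemma frobenius_norm_adjoint:
  assumes "A \<in> carrier_mat n n"
  shows "frobenius_norm (mat_adjoint A) = frobenius_norm A"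
proof -
  have "(frobenius_norm (mat_adjoint A))\<^sup>2 = (\<Sum>i<n. \<Sum>j<n. (cmod (A $$ (j, i)))\<^sup>2)"
    using assms by (simp add: frobenius_norm_sq[OF mat_adjoint_carrier] index_mat_adjoint)
  also have "\<dots> = (frobenius_norm A)\<^sup>2"
    by (subst sum.swap) (simp add: frobenius_norm_sq[OF assms])
  finally show ?thesis by (simp add: power2_eq_iff_nonneg frobenius_norm_nonneg)
qed

text \<open>The operator norm of a matrix is the norm of left multiplication by it on the matrices with the
  Frobenius norm. In this form the bound combines directly with \<^const>\<open>frobenius_norm\<close>, without a
  second norm on vectors.\<close>

definition mult_bounded :: "nat \<Rightarrow> complex mat \<Rightarrow> real \<Rightarrow> bool" where
  "mult_bounded n A M \<longleftrightarrow>
     A \<in> carrier_mat n n \<and> (\<forall>Z\<in>carrier_mat n n. frobenius_norm (A * Z) \<le> M * frobenius_norm Z)"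

lemma mult_bounded_minus:
  assumes X: "mult_bounded n X M" and Y: "mult_bounded n Y N"
  shows "mult_bounded n (X - Y) (M + N)"
  unfolding mult_bounded_def
proof (intro conjI ballI)
  have c: "X \<in> carrier_mat n n" "Y \<in> carrier_mat n n" using X Y by (auto simp: mult_bounded_def)
  show "X - Y \<in> carrier_mat n n" using c(2) by (rule minus_carrier_mat)
  fix Z :: "complex mat" assume Z: "Z \<in> carrier_mat n n"
  have "(X - Y) * Z = X * Z - Y * Z" by (rule minus_mult_distrib_mat[OF c Z])
  also have "frobenius_norm \<dots> \<le> frobenius_norm (X * Z) + frobenius_norm (Y * Z)"
    using c Z by (intro frobenius_norm_diff_le[of _ n]) auto
  also have "\<dots> \<le> M * frobenius_norm Z + N * frobenius_norm Z"
    using X Y Z by (intro add_mono) (auto simp: mult_bounded_def)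
  finally show "frobenius_norm ((X - Y) * Z) \<le> (M + N) * frobenius_norm Z" by (simp add: distrib_right)
qed

lemma mat_adjoint_mult:
  fixes A :: "complex mat"
  assumes "A \<in> carrier_mat n n" "B \<in> carrier_mat n n"
  shows "mat_adjoint (A * B) = mat_adjoint B * mat_adjoint A"
proof (rule eq_matI)
  have c: "A * B \<in> carrier_mat n n" "mat_adjoint A \<in> carrier_mat n n" "mat_adjoint B \<in> carrier_mat n n"
    using assms by (auto intro: mat_adjoint_carrier)
  show "dim_row (mat_adjoint (A * B)) = dim_row (mat_adjoint B * mat_adjoint A)"
    "dim_col (mat_adjoint (A * B)) = dim_col (mat_adjoint B * mat_adjoint A)"
    using c mat_adjoint_carrier[OF c(1)] by auto
  fix i j assume "i < dim_row (mat_adjoint B * mat_adjoint A)" "j < dim_col (mat_adjoint B * mat_adjoint A)"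
  hence ij: "i < n" "j < n" using c by auto
  show "mat_adjoint (A * B) $$ (i, j) = (mat_adjoint B * mat_adjoint A) $$ (i, j)"
    unfolding index_mat_adjoint[OF c(1) ij] mult_entry[OF c(3,2) ij] mult_entry[OF assms ij(2,1)]
    using assms ij by (auto simp: index_mat_adjoint mult.commute intro!: sum.cong)
qed

lemma mat_adjoint_minus:
  fixes A :: "complex mat"
  assumes "A \<in> carrier_mat n n" "B \<in> carrier_mat n n"
  shows "mat_adjoint (A - B) = mat_adjoint A - mat_adjoint B"
  using assms mat_adjoint_carrier[OF assms(1)] mat_adjoint_carrier[OF assms(2)]
    mat_adjoint_carrier[of "A - B" n n] minus_carrier_mat[OF assms(2), of A]
  by (intro eq_matI) (auto simp: index_mat_adjoint[of _ n n])

lemma mat_adjoint_sum_mats: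
  assumes "\<And>k. k \<in> I \<Longrightarrow> F k \<in> carrier_mat n n"
  shows "mat_adjoint (sum_mats n F I) = sum_mats n (\<lambda>k. mat_adjoint (F k)) I"
  using mat_adjoint_carrier[OF sum_mats_carrier[of n F I]]
    sum_mats_carrier[of n "\<lambda>k. mat_adjoint (F k)" I] assms
  by (intro eq_matI) (auto simp: index_mat_adjoint[of _ n n] sum_mats_def)

lemma fip_minus_left:
  "A \<in> carrier_mat n n \<Longrightarrow> B \<in> carrier_mat n n \<Longrightarrow> fip n (A - B) C = fip n A C - fip n B C"
  by (simp add: fip_def ring_distribs sum_subtractf)

lemma fip_self:
  assumes "A \<in> carrier_mat n n"
  shows "fip n A A = of_real ((frobenius_norm A)\<^sup>2)"
proof -
  have "Im (fip n A A) = - Im (fip n A A)" using arg_cong[OF fip_cnj[of n A A], of Im] by simp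
  hence "Im (fip n A A) = 0" by simp
  thus ?thesis by (simp add: frobenius_norm_fip[OF assms] complex_eq_iff)
qed

section \<open>Pinchings as conditional expectations\<close>

lemma projection_familyD:
  assumes "projection_family n m P" "k \<in> {1..m}"
  shows "P k \<in> carrier_mat n n" "mat_adjoint (P k) = P k" "P k * P k = P k"
  using assms by (auto simp: projection_family_def orth_projection_def)

text \<open>The range of a pinching commutes with the projections; \<open>pinching_fixes_commutant\<close> is the
  converse. Together they identify the range with a commutant, which makes it closed under products.\<close>

lemma pinching_commute:
  assumes P: "projection_family n m P" and X: "X \<in> carrier_mat n n" and k: "k \<in> {1..m}"
  shows "P k * pinching n m P X = P k * X * P k"
    and "pinching n m P X * P k = P k * X * P k"
proof -
  note D = projection_familyD[OF P]
  note ass = assoc_mult_mat[of _ n n _ n _ n]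
  have O: "P j * P l = 0\<^sub>m n n" if "l \<in> {1..m}" "j \<in> {1..m}" "j \<noteq> l" for j l
    using P that by (auto simp: projection_family_def)
  have C: "P j * X * P j \<in> carrier_mat n n" if "j \<in> {1..m}" for j
    using D(1)[OF that] X by (intro mult_carrier_mat[of _ n n]) auto
  have kk: "P k * X * P k \<in> carrier_mat n n" by (rule C[OF k])
  have "P k * pinching n m P X = sum_mats n (\<lambda>j. P k * (P j * X * P j)) {1..m}"
    unfolding pinching_def using C D(1)[OF k] by (intro mult_sum_mats) auto
  also have "\<dots> = sum_mats n (\<lambda>j. if j = k then P k * X * P k else 0\<^sub>m n n) {1..m}"
  proof (rule sum_mats_cong)
    fix j assume j: "j \<in> {1..m}"
    have "P k * (P j * X * P j) = (P k * P j) * X * P j"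
      using D(1)[OF k] D(1)[OF j] X by (simp add: ass)
    thus "P k * (P j * X * P j) = (if j = k then P k * X * P k else 0\<^sub>m n n)"
      using D(1,3)[OF k] D(1)[OF j] X O[OF j k] by (cases "j = k") auto
  qed
  also have "\<dots> = P k * X * P k" using k kk by (intro sum_mats_delta) auto
  finally show "P k * pinching n m P X = P k * X * P k" .
  have "pinching n m P X * P k = sum_mats n (\<lambda>j. P j * X * P j * P k) {1..m}"
    unfolding pinching_def using C D(1)[OF k] by (intro sum_mats_mult) auto
  also have "\<dots> = sum_mats n (\<lambda>j. if j = k then P k * X * P k else 0\<^sub>m n n) {1..m}"
  proof (rule sum_mats_cong)
    fix j assume j: "j \<in> {1..m}"
    have "P j * X * P j * P k = P j * X * (P j * P k)"
      using D(1)[OF k] D(1)[OF j] X by (simp add: ass)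
    thus "P j * X * P j * P k = (if j = k then P k * X * P k else 0\<^sub>m n n)"
      using D(1,3)[OF k] D(1)[OF j] X O[OF k j] by (cases "j = k") auto
  qed
  also have "\<dots> = P k * X * P k" using k kk by (intro sum_mats_delta) auto
  finally show "pinching n m P X * P k = P k * X * P k" .
qed

lemma pinching_fixes_commutant:
  assumes P: "projection_family n m P" and Z: "Z \<in> carrier_mat n n"
    and comm: "\<And>k. k \<in> {1..m} \<Longrightarrow> P k * Z = Z * P k"
  shows "pinching n m P Z = Z"
proof -
  note D = projection_familyD[OF P]
  have "pinching n m P Z = sum_mats n (\<lambda>k. Z * P k) {1..m}"
    unfolding pinching_def
  proof (rule sum_mats_cong)
    fix k assume k: "k \<in> {1..m}"
    show "P k * Z * P k = Z * P k"
      unfolding comm[OF k] using assoc_mult_mat[OF Z D(1)[OF k] D(1)[OF k]] D(3)[OF k] by simp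
  qed
  also have "\<dots> = Z * sum_mats n P {1..m}"
    using Z D(1) by (intro mult_sum_mats[symmetric]) auto
  also have "\<dots> = Z" using P Z by (simp add: projection_family_def)
  finally show ?thesis .
qed

lemma pinching_mult_pinching:
  assumes P: "projection_family n m P" and X: "X \<in> carrier_mat n n" and Y: "Y \<in> carrier_mat n n"
  shows "pinching n m P (pinching n m P X * pinching n m P Y) = pinching n m P X * pinching n m P Y"
proof (rule pinching_fixes_commutant[OF P])
  let ?X = "pinching n m P X" and ?Y = "pinching n m P Y"
  show "?X * ?Y \<in> carrier_mat n n" by (intro mult_carrier_mat[of _ n n]) auto
  fix k assume k: "k \<in> {1..m}"
  note c = projection_familyD(1)[OF P k] pinching_carrier
  have "P k * (?X * ?Y) = (P k * ?X) * ?Y" by (rule assoc_mult_mat[symmetric]) (rule c)+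
  also have "P k * ?X = ?X * P k" by (simp only: pinching_commute[OF P X k])
  also have "\<dots> * ?Y = ?X * (P k * ?Y)" by (rule assoc_mult_mat) (rule c)+
  also have "P k * ?Y = ?Y * P k" by (simp only: pinching_commute[OF P Y k])
  also have "?X * (?Y * P k) = ?X * ?Y * P k" by (rule assoc_mult_mat[symmetric]) (rule c)+
  finally show "P k * (?X * ?Y) = ?X * ?Y * P k" .
qed

lemma pinching_adjoint:
  assumes P: "projection_family n m P" and X: "X \<in> carrier_mat n n"
  shows "mat_adjoint (pinching n m P X) = pinching n m P (mat_adjoint X)"
proof -
  note D = projection_familyD[OF P]
  have C: "P k * X * P k \<in> carrier_mat n n" if "k \<in> {1..m}" for k
    using D(1)[OF that] X by (intro mult_carrier_mat[of _ n n]) auto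
  have "mat_adjoint (P k * X * P k) = P k * mat_adjoint X * P k" if "k \<in> {1..m}" for k
  proof -
    have "mat_adjoint (P k * X * P k) = P k * (mat_adjoint X * P k)"
      using D(1,2)[OF that] X by (subst mat_adjoint_mult[of _ n]) (auto simp: mat_adjoint_mult[of _ n])
    thus ?thesis using D(1)[OF that] mat_adjoint_carrier[OF X] by (simp add: assoc_mult_mat[of _ n n _ n _ n])
  qed
  thus ?thesis unfolding pinching_def using C by (subst mat_adjoint_sum_mats) (auto intro: sum_mats_cong)
qed

text \<open>A pinching is idempotent and self-adjoint for the Frobenius inner product, hence an orthogonal
  projection: with \<open>W = X - Z\<close> the left side is the norm of \<open>W\<close> minus its projection.\<close>

lemma pinching_best_approximation:
  assumes P: "projection_family n m P" and X: "X \<in> carrier_mat n n" and Z: "Z \<in> carrier_mat n n"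
    and fix_Z: "pinching n m P Z = Z"
  shows "frobenius_norm (X - pinching n m P X) \<le> frobenius_norm (X - Z)"
proof -
  define W where "W = X - Z"
  define V where "V = pinching n m P W"
  have W: "W \<in> carrier_mat n n" and V: "V \<in> carrier_mat n n" using X Z by (auto simp: W_def V_def)
  have "X - pinching n m P X = W - V"
    using X Z fix_Z carrier_matD[OF pinching_carrier[of n m P X]]
    by (intro eq_matI) (auto simp: V_def W_def pinching_minus[OF P])
  moreover have "(frobenius_norm (W - V))\<^sup>2 + (frobenius_norm V)\<^sup>2 = (frobenius_norm W)\<^sup>2"
  proof -
    have "fip n V W = fip n V V" "fip n W V = fip n V V"
      using fip_pinching[OF P W V] fip_pinching[OF P V W] pinching_idem[OF P W]
      by (simp_all add: V_def)
    thus ?thesis using W V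
      by (simp add: frobenius_norm_fip[of _ n] fip_minus_left fip_minus_right minus_carrier_mat)
  qed
  ultimately show ?thesis unfolding W_def
    by (intro power2_le_imp_le[OF _ frobenius_norm_nonneg]) (smt (verit) zero_le_power2)
qed

lemma projection_family_pythagoras:
  assumes P: "projection_family n m P" and W: "W \<in> carrier_mat n n"
  shows "(frobenius_norm W)\<^sup>2 = (\<Sum>k\<in>{1..m}. (frobenius_norm (P k * W))\<^sup>2)"
proof -
  note D = projection_familyD[OF P]
  have c: "P k * W \<in> carrier_mat n n" if "k \<in> {1..m}" for k
    using D(1)[OF that] W by auto
  have "W = sum_mats n P {1..m} * W" using P W by (simp add: projection_family_def)
  also have "\<dots> = sum_mats n (\<lambda>k. P k * W) {1..m}" using D(1) W by (intro sum_mats_mult) auto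
  finally have "fip n W W = fip n (sum_mats n (\<lambda>k. P k * W) {1..m}) W" by simp
  also have "\<dots> = (\<Sum>k\<in>{1..m}. fip n (P k * W) W)" by (rule fip_sum_mats_left)
  also have "\<dots> = (\<Sum>k\<in>{1..m}. fip n (P k * W) (P k * W))"
  proof (rule sum.cong)
    fix k assume k: "k \<in> {1..m}"
    have "fip n (P k * W) (P k * W) = fip n (P k * (P k * W)) W"
      using fip_mult_left[of "P k" n "P k * W" W] D(1,2)[OF k] c[OF k] W by simp
    also have "P k * (P k * W) = P k * W"
      using assoc_mult_mat[OF D(1)[OF k] D(1)[OF k] W] D(3)[OF k] by simp
    finally show "fip n (P k * W) W = fip n (P k * W) (P k * W)" by simp
  qed simp
  finally have "Re (fip n W W) = (\<Sum>k\<in>{1..m}. Re (fip n (P k * W) (P k * W)))" by simp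
  moreover have "(frobenius_norm (P k * W))\<^sup>2 = Re (fip n (P k * W) (P k * W))"
    if "k \<in> {1..m}" for k
    by (rule frobenius_norm_fip[OF c[OF that]])
  ultimately show ?thesis by (simp add: frobenius_norm_fip[OF W])
qed

text \<open>The compression \<open>P\<^sub>k X P\<^sub>k\<close> of \<open>X\<close> to each block has norm at most \<open>M\<close>, and the blocks are mutually
  orthogonal, so the squared norms add up on both sides.\<close>

lemma mult_bounded_pinching:
  assumes P: "projection_family n m P" and X: "mult_bounded n X M" and M: "0 \<le> M"
  shows "mult_bounded n (pinching n m P X) M"
  unfolding mult_bounded_def
proof (intro conjI ballI)
  show "pinching n m P X \<in> carrier_mat n n" by simp
  fix Z :: "complex mat" assume Z: "Z \<in> carrier_mat n n"
  note D = projection_familyD[OF P]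
  have Xc: "X \<in> carrier_mat n n" using X by (simp add: mult_bounded_def)
  have block: "frobenius_norm (P k * (pinching n m P X * Z)) \<le> M * frobenius_norm (P k * Z)"
    if k: "k \<in> {1..m}" for k
  proof -
    have c: "P k * Z \<in> carrier_mat n n" "X * (P k * Z) \<in> carrier_mat n n" using D(1)[OF k] Xc Z by auto
    have "P k * (pinching n m P X * Z) = P k * pinching n m P X * Z"
      using D(1)[OF k] Z by (intro assoc_mult_mat[symmetric]) auto
    also have "\<dots> = P k * (X * (P k * Z))"
      unfolding pinching_commute[OF P Xc k] using D(1)[OF k] Xc Z
      by (simp add: assoc_mult_mat[of _ n n _ n _ n])
    finally have eq: "P k * (pinching n m P X * Z) = P k * (X * (P k * Z))" .
    have "(frobenius_norm (P k * (X * (P k * Z))))\<^sup>2 \<le> (frobenius_norm (X * (P k * Z)))\<^sup>2"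
      unfolding projection_family_pythagoras[OF P c(2)] using k
      by (intro member_le_sum[of k "{1..m}" "\<lambda>j. (frobenius_norm (P j * (X * (P k * Z))))\<^sup>2"]) auto
    hence "frobenius_norm (P k * (X * (P k * Z))) \<le> frobenius_norm (X * (P k * Z))"
      by (rule power2_le_imp_le) (rule frobenius_norm_nonneg)
    also have "\<dots> \<le> M * frobenius_norm (P k * Z)" using X c(1) by (simp add: mult_bounded_def)
    finally show ?thesis by (simp only: eq)
  qed
  have "(frobenius_norm (pinching n m P X * Z))\<^sup>2
      = (\<Sum>k\<in>{1..m}. (frobenius_norm (P k * (pinching n m P X * Z)))\<^sup>2)"
    using Z by (intro projection_family_pythagoras[OF P]) (auto intro: mult_carrier_mat[of _ n n])
  also have "\<dots> \<le> (\<Sum>k\<in>{1..m}. (M * frobenius_norm (P k * Z))\<^sup>2)"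
    by (intro sum_mono power_mono block frobenius_norm_nonneg)
  also have "\<dots> = (M * frobenius_norm Z)\<^sup>2"
    unfolding power_mult_distrib projection_family_pythagoras[OF P Z] sum_distrib_left ..
  finally show "frobenius_norm (pinching n m P X * Z) \<le> M * frobenius_norm Z"
    by (rule power2_le_imp_le) (simp add: M frobenius_norm_nonneg)
qed

text \<open>Conjugation by \<open>U\<close> turns the projections into another orthogonal family. The unitary is absorbed
  there, and all facts about pinchings apply to the preconditioner.\<close>

lemma precond_eq_pinching:
  assumes U: "unitary_mat n U" and P: "projection_family n m P"
  defines "Q \<equiv> \<lambda>k. U * P k * mat_adjoint U"
  shows "projection_family n m Q"
    and "X \<in> carrier_mat n n \<Longrightarrow> precond n m P U X = pinching n m Q X"
proof -
  define V where "V = mat_adjoint U"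
  note D = projection_familyD[OF P]
  note ass = assoc_mult_mat[of _ n n _ n _ n]
  have UV [simp]: "U \<in> carrier_mat n n" "V \<in> carrier_mat n n" "U * V = 1\<^sub>m n" "V * U = 1\<^sub>m n"
    and adj: "mat_adjoint U = V" "mat_adjoint V = U"
    using U mat_adjoint_carrier[of U n n] mat_adjoint_involutive[of U n n]
    by (auto simp: unitary_mat_def V_def)
  have Q_eq: "Q k = U * P k * V" for k by (simp add: Q_def V_def)
  have QQ: "Q j * Q k = U * (P j * P k) * V" if j: "j \<in> {1..m}" and k: "k \<in> {1..m}" for j k
  proof -
    have "Q j * Q k = U * (P j * ((V * U) * (P k * V)))"
      unfolding Q_eq using D(1)[OF j] D(1)[OF k] by (simp add: ass mult_carrier_mat[of _ n n] del: UV(4))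
    also have "\<dots> = U * (P j * P k) * V"
      using D(1)[OF j] D(1)[OF k] by (simp add: ass mult_carrier_mat[of _ n n])
    finally show ?thesis .
  qed
  have Qc: "Q k \<in> carrier_mat n n" if "k \<in> {1..m}" for k
    using D(1)[OF that] by (auto simp: Q_eq intro!: mult_carrier_mat[of _ n n])
  have Qsum: "sum_mats n (\<lambda>k. U * F k * V) I = U * sum_mats n F I * V"
    if "\<And>k. k \<in> I \<Longrightarrow> F k \<in> carrier_mat n n" for F and I :: "nat set"
    using that by (subst mult_sum_mats, simp, simp, subst sum_mats_mult)
      (auto intro!: mult_carrier_mat[of _ n n])
  show "projection_family n m Q"
    unfolding projection_family_def orth_projection_def
  proof (intro conjI ballI impI)
    fix k assume k: "k \<in> {1..m}"
    show "Q k \<in> carrier_mat n n" by (rule Qc[OF k])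
    show "mat_adjoint (Q k) = Q k"
      unfolding Q_eq using D(1,2)[OF k]
      by (subst mat_adjoint_mult[of _ n])
        (auto simp: mat_adjoint_mult[of _ n] adj ass intro: mult_carrier_mat[of _ n n])
    show "Q k * Q k = Q k" using QQ[OF k k] D(3)[OF k] by (simp add: Q_eq)
    fix j assume j: "j \<in> {1..m}" "j \<noteq> k"
    have "P j * P k = 0\<^sub>m n n" using P j k by (simp add: projection_family_def)
    thus "Q j * Q k = 0\<^sub>m n n" 
      using QQ[OF j(1) k] right_mult_zero_mat[OF UV(1)] left_mult_zero_mat[OF UV(2)] by simp
  next
    have "sum_mats n Q {1..m} = U * sum_mats n P {1..m} * V"
      unfolding Q_eq[abs_def] using D(1) by (rule Qsum)
    also have "sum_mats n P {1..m} = 1\<^sub>m n" using P by (simp add: projection_family_def)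
    also have "U * 1\<^sub>m n * V = 1\<^sub>m n" using right_mult_one_mat[OF UV(1)] by simp
    finally show "sum_mats n Q {1..m} = 1\<^sub>m n" .
  qed
  assume X: "X \<in> carrier_mat n n"
  have "precond n m P U X = U * sum_mats n (\<lambda>k. P k * (V * X * U) * P k) {1..m} * V"
    unfolding precond_eq[OF U P X] pinching_def V_def ..
  also have "\<dots> = sum_mats n (\<lambda>k. U * (P k * (V * X * U) * P k) * V) {1..m}"
    using D(1) X by (intro Qsum[symmetric] mult_carrier_mat[of _ n n]) auto
  also have "\<dots> = pinching n m Q X"
    unfolding pinching_def
  proof (rule sum_mats_cong)
    fix k assume k: "k \<in> {1..m}"
    show "U * (P k * (V * X * U) * P k) * V = Q k * X * Q k"
      unfolding Q_eq using D(1)[OF k] X by (simp add: ass mult_carrier_mat[of _ n n] del: UV(4))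
  qed
  finally show "precond n m P U X = pinching n m Q X" .
qed

section \<open>Singular values and the Frobenius norm\<close>

definition mat_trace :: "complex mat \<Rightarrow> complex" where
  "mat_trace A = (\<Sum>i<dim_row A. A $$ (i, i))"

lemma mat_trace_mult_commute:
  assumes "A \<in> carrier_mat n n" "B \<in> carrier_mat n n"
  shows "mat_trace (A * B) = mat_trace (B * A)"
proof -
  have "mat_trace (A * B) = (\<Sum>i<n. \<Sum>j<n. A $$ (i, j) * B $$ (j, i))"
    using assms by (auto simp: mat_trace_def mult_entry simp del: index_mult_mat(1))
  also have "\<dots> = (\<Sum>j<n. \<Sum>i<n. B $$ (j, i) * A $$ (i, j))"
    by (subst sum.swap) (simp add: mult.commute)
  also have "\<dots> = mat_trace (B * A)"
    using assms by (auto simp: mat_trace_def mult_entry simp del: index_mult_mat(1))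
  finally show ?thesis .
qed

text \<open>Schur's triangular form has the roots of the characteristic polynomial on its diagonal, with
  multiplicity, and similarity preserves the trace.\<close>

lemma eigenvalues_size_and_sum:
  fixes A :: "complex mat"
  assumes A: "A \<in> carrier_mat n n"
  shows "size (proots (char_poly A)) = n" and "\<Sum>\<^sub># (proots (char_poly A)) = mat_trace A"
proof -
  obtain as where "char_poly A = (\<Prod>a\<leftarrow>as. [:- a, 1:])" using char_poly_factorized[OF A] by auto
  then obtain B where B: "B \<in> carrier_mat n n" "upper_triangular B" "similar_mat A B"
    using schur_decomposition_exists[OF A] by blast
  have "char_poly A = (\<Prod>a\<leftarrow>diag_mat B. [:- a, 1:])"
    using char_poly_similar[OF B(3)] char_poly_upper_triangular[OF B(1,2)] by simp
  also have "proots \<dots> = mset (diag_mat B)"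
  proof -
    have "proots (\<Prod>a\<leftarrow>as. [:- a, 1:]) = mset as" for as :: "complex list"
    proof (induction as)
      case (Cons a as)
      have "(\<Prod>a\<leftarrow>as. [:- a, 1:]) \<noteq> 0" by (auto simp: prod_list_zero_iff)
      thus ?case using Cons by (simp add: proots_mult del: mult_pCons_left)
    qed simp
    thus ?thesis .
  qed
  finally have roots: "proots (char_poly A) = mset (diag_mat B)" .
  from roots B(1) show "size (proots (char_poly A)) = n" by (simp add: diag_mat_def)
  obtain P Q where "similar_mat_wit A B P Q" using B(3) by (auto simp: similar_mat_def)
  hence PQ: "P \<in> carrier_mat n n" "Q \<in> carrier_mat n n" "Q * P = 1\<^sub>m n" "A = P * B * Q"
    using A by (auto simp: similar_mat_wit_def Let_def)
  have "\<Sum>\<^sub># (proots (char_poly A)) = mat_trace B"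
    unfolding roots using B(1)
    by (simp add: diag_mat_def mat_trace_def sum_mset_sum_list interv_sum_list_conv_sum_set_nat
        atLeast0LessThan sum_unfold_sum_mset)
  also have "B = Q * (P * B)"
    using PQ B(1) assoc_mult_mat[of Q n n P n B n] by simp
  hence "mat_trace B = mat_trace (Q * (P * B))" by simp
  also have "\<dots> = mat_trace A"
    unfolding PQ(4) using PQ(1,2) B(1) by (intro mat_trace_mult_commute) auto
  finally show "\<Sum>\<^sub># (proots (char_poly A)) = mat_trace A" .
qed

text \<open>An eigenvector \<open>v\<close> with \<open>A\<^sup>*A v = z v\<close> satisfies \<open>\<parallel>A v\<parallel>\<^sup>2 = z \<parallel>v\<parallel>\<^sup>2\<close>. The witness \<open>V\<close> repeats \<open>v\<close> in
  every column, so that the identity can be read in the Frobenius inner product.\<close>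

lemma gram_eigenvalue:
  assumes A: "A \<in> carrier_mat n n" and z: "z \<in># proots (char_poly (mat_adjoint A * A))"
  shows "\<exists>V. V \<in> carrier_mat n n \<and> frobenius_norm V > 0
    \<and> z = of_real ((frobenius_norm (A * V))\<^sup>2 / (frobenius_norm V)\<^sup>2)"
proof -
  let ?B = "mat_adjoint A * A"
  have adj: "mat_adjoint A \<in> carrier_mat n n" using A by (rule mat_adjoint_carrier)
  hence B: "?B \<in> carrier_mat n n" using A by auto
  have "char_poly ?B \<noteq> 0" using degree_monic_char_poly[OF B] by auto
  with z have "poly (char_poly ?B) z = 0" by simp
  then obtain v where v: "v \<in> carrier_vec n" "v \<noteq> 0\<^sub>v n" "?B *\<^sub>v v = z \<cdot>\<^sub>v v"
    using carrier_matD(1)[OF B] eigenvalue_root_char_poly[OF B, of z]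
    by (auto simp: eigenvalue_def eigenvector_def)
  obtain i0 where i0: "i0 < n" "v $ i0 \<noteq> 0" using v(1,2) by (metis carrier_vecD eq_vecI index_zero_vec(1,2))
  define V where "V = mat n n (\<lambda>(i, j). v $ i)"
  have V: "V \<in> carrier_mat n n" by (simp add: V_def)
  have V_pos: "frobenius_norm V > 0"
  proof -
    have "frobenius_norm V \<noteq> 0"
    proof
      assume "frobenius_norm V = 0"
      hence "V $$ (i0, i0) = 0" using frobenius_norm_zero_imp[OF V] i0 by simp
      thus False using i0 by (simp add: V_def)
    qed
    thus ?thesis using frobenius_norm_nonneg[of V] by linarith
  qed
  have eig: "?B * V = z \<cdot>\<^sub>m V"
  proof (rule eq_matI)
    fix i j assume "i < dim_row (z \<cdot>\<^sub>m V)" "j < dim_col (z \<cdot>\<^sub>m V)"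
    hence ij: "i < n" "j < n" by (auto simp: V_def)
    have "col V j = v" using v(1) ij by (intro eq_vecI) (auto simp: V_def)
    hence "(?B * V) $$ (i, j) = (?B *\<^sub>v v) $ i" using ij adj V by (simp add: carrier_matD)
    thus "(?B * V) $$ (i, j) = (z \<cdot>\<^sub>m V) $$ (i, j)" using v(1,3) ij by (simp add: V_def)
  qed (use A V adj in auto)
  have "fip n (A * V) (A * V) = fip n V (mat_adjoint A * (A * V))"
    using A V by (intro fip_mult_left) auto
  also have "mat_adjoint A * (A * V) = z \<cdot>\<^sub>m V"
    using eig assoc_mult_mat[OF adj A V] by simp
  also have "fip n V (z \<cdot>\<^sub>m V) = z * fip n V V"
    using V by (auto simp: fip_def sum_distrib_left intro!: sum.cong)
  finally have "of_real ((frobenius_norm (A * V))\<^sup>2) = z * of_real ((frobenius_norm V)\<^sup>2)"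
    using A V by (simp add: fip_self[of _ n])
  hence "z = of_real ((frobenius_norm (A * V))\<^sup>2 / (frobenius_norm V)\<^sup>2)"
    using V_pos by (simp add: field_simps)
  with V V_pos show ?thesis by blast
qed

text \<open>The squares of the singular values are the eigenvalues of \<open>A\<^sup>*A\<close>, so their sum is its trace, which is
  the sum of the squared moduli of the entries of \<open>A\<close>.\<close>

lemma
  assumes A: "A \<in> carrier_mat n n"
  shows size_singular_values: "size (singular_values A) = n"
    and singular_values_nonneg: "s \<in># singular_values A \<Longrightarrow> 0 \<le> s"
    and singular_values_le: "mult_bounded n A M \<Longrightarrow> 0 \<le> M \<Longrightarrow> s \<in># singular_values A \<Longrightarrow> s \<le> M"
    and sum_singular_values_sq: "(\<Sum>s\<in>#singular_values A. s\<^sup>2) = (frobenius_norm A)\<^sup>2"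
proof -
  let ?B = "mat_adjoint A * A"
  have adj: "mat_adjoint A \<in> carrier_mat n n" using A by (rule mat_adjoint_carrier)
  hence B: "?B \<in> carrier_mat n n" using A by auto
  note eig = gram_eigenvalue[OF A]
  show "size (singular_values A) = n"
    by (simp add: singular_values_def eigenvalues_size_and_sum(1)[OF B])
  show "0 \<le> s" if s: "s \<in># singular_values A"
  proof -
    obtain z where z: "z \<in># proots (char_poly ?B)" "s = sqrt (Re z)"
      using s by (auto simp: singular_values_def)
    from eig[OF z(1)] z(2) show ?thesis by auto
  qed
  show "s \<le> M" if bd: "mult_bounded n A M" and M: "0 \<le> M" and s: "s \<in># singular_values A"
  proof -
    obtain z where z: "z \<in># proots (char_poly ?B)" "s = sqrt (Re z)"
      using s by (auto simp: singular_values_def)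
    obtain V where V: "V \<in> carrier_mat n n" "frobenius_norm V > 0"
      "z = of_real ((frobenius_norm (A * V))\<^sup>2 / (frobenius_norm V)\<^sup>2)"
      using eig[OF z(1)] by blast
    have "s = frobenius_norm (A * V) / frobenius_norm V"
      unfolding z(2) V(3) using V(2) frobenius_norm_nonneg[of "A * V"]
      by (simp add: real_sqrt_divide)
    also have "\<dots> \<le> M" using bd V(1,2) by (simp add: mult_bounded_def divide_le_eq)
    finally show ?thesis .
  qed
  have "(\<Sum>s\<in>#singular_values A. s\<^sup>2) = (\<Sum>z\<in>#proots (char_poly ?B). Re z)"
    unfolding singular_values_def image_mset.compositionality o_def
    by (rule arg_cong[of _ _ sum_mset], rule image_mset_cong) (use eig in force)
  also have "\<dots> = Re (\<Sum>\<^sub># (proots (char_poly ?B)))"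
  proof -
    have "(\<Sum>z\<in>#R. Re z) = Re (\<Sum>\<^sub># R)" for R by (induction R) auto
    thus ?thesis .
  qed
  also have "\<Sum>\<^sub># (proots (char_poly ?B)) = mat_trace ?B" by (rule eigenvalues_size_and_sum(2)[OF B])
  also have "mat_trace ?B = (\<Sum>i<n. \<Sum>j<n. cnj (A $$ (j, i)) * A $$ (j, i))"
    unfolding mat_trace_def using A B adj
    by (auto simp: mult_entry[OF adj A] index_mat_adjoint[OF A] simp del: index_mult_mat(1) intro!: sum.cong)
  also have "\<dots> = fip n A A" unfolding fip_def by (rule sum.swap)
  also have "Re (fip n A A) = (frobenius_norm A)\<^sup>2" by (simp add: frobenius_norm_fip[OF A])
  finally show "(\<Sum>s\<in>#singular_values A. s\<^sup>2) = (frobenius_norm A)\<^sup>2" .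
qed

section \<open>Weak clusters as small normalised Frobenius norm\<close>

definition frob_small :: "(nat \<Rightarrow> complex mat) \<Rightarrow> bool" where
  "frob_small X \<longleftrightarrow> (\<lambda>n. frobenius_norm (X n)) \<in> o(\<lambda>n. sqrt (real n))"

lemma frob_small_iff:
  "frob_small X \<longleftrightarrow> (\<forall>\<epsilon>>0. \<forall>\<^sub>F n in sequentially. frobenius_norm (X n) \<le> \<epsilon> * sqrt (real n))"
  by (simp add: frob_small_def smallo_def frobenius_norm_nonneg)

lemma frob_small_mono:
  assumes "frob_small X" "\<forall>\<^sub>F n in sequentially. frobenius_norm (Y n) \<le> C * frobenius_norm (X n)"
  shows "frob_small Y"
  using assms(1) unfolding frob_small_def
  by (rule landau_o.big_small_trans[rotated])
    (rule bigoI[of _ C], use assms(2) in \<open>simp add: frobenius_norm_nonneg\<close>)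

lemma frob_small_triangle:
  assumes X: "frob_small X" and Y: "frob_small Y"
    and le: "\<forall>\<^sub>F n in sequentially.
      frobenius_norm (Z n) \<le> C * frobenius_norm (X n) + D * frobenius_norm (Y n)"
  shows "frob_small Z"
proof -
  have "(\<lambda>n. C * frobenius_norm (X n) + D * frobenius_norm (Y n)) \<in> o(\<lambda>n. sqrt (real n))"
    using X Y unfolding frob_small_def 
    by (cases "C = 0"; cases "D = 0") (auto intro!: sum_in_smallo)
  moreover have "(\<lambda>n. frobenius_norm (Z n)) \<in> O(\<lambda>n. C * frobenius_norm (X n) + D * frobenius_norm (Y n))"
    by (rule bigoI[of _ 1]) (use le in eventually_elim, smt (verit) frobenius_norm_nonneg real_norm_def)
  ultimately show ?thesis unfolding frob_small_def by (rule landau_o.big_small_trans[rotated])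
qed

text \<open>Smallness at the scale \<open>\<surd>n\<close> survives limits that are uniform at this scale; this is what allows
  passing from trigonometric polynomials to continuous functions, and to uniform limits.\<close>

lemma frob_small_approx:
  assumes "\<And>\<epsilon>. \<epsilon> > 0 \<Longrightarrow> \<exists>Y. frob_small Y \<and>
      (\<forall>\<^sub>F n in sequentially. frobenius_norm (X n) \<le> frobenius_norm (Y n) + \<epsilon> * sqrt (real n))"
  shows "frob_small X"
  unfolding frob_small_iff
proof (intro allI impI)
  fix \<epsilon> :: real assume "\<epsilon> > 0"
  hence e: "\<epsilon> / 2 > 0" by simp
  obtain Y where Y: "frob_small Y"
    "\<forall>\<^sub>F n in sequentially. frobenius_norm (X n) \<le> frobenius_norm (Y n) + \<epsilon> / 2 * sqrt (real n)"
    using assms[OF e] by blast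
  from Y(1)[unfolded frob_small_iff, rule_format, OF e] Y(2)
  show "\<forall>\<^sub>F n in sequentially. frobenius_norm (X n) \<le> \<epsilon> * sqrt (real n)"
    by eventually_elim (simp add: field_simps)
qed

lemma outliers_le_sum_sq:
  fixes S :: "real multiset"
  assumes "\<epsilon> > 0" "\<And>s. s \<in># S \<Longrightarrow> 0 \<le> s"
  shows "\<epsilon>\<^sup>2 * real (size (filter_mset (\<lambda>s. s \<notin> {0..<\<epsilon>}) S)) \<le> (\<Sum>s\<in>#S. s\<^sup>2)"
  using assms(2)
proof (induction S)
  case (add s S)
  have "\<epsilon>\<^sup>2 \<le> s\<^sup>2" if "\<not> s < \<epsilon>" using that assms(1) by (intro power_mono) auto
  moreover have "0 \<le> s" using add.prems by simp
  moreover have "\<epsilon>\<^sup>2 * real (size (filter_mset (\<lambda>s. s \<notin> {0..<\<epsilon>}) S)) \<le> (\<Sum>s\<in>#S. s\<^sup>2)"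
    using add by simp
  ultimately show ?case by (cases "s < \<epsilon>") (simp_all add: distrib_left add_increasing)
qed simp

lemma sum_sq_le_outliers:
  fixes S :: "real multiset"
  assumes "\<And>s. s \<in># S \<Longrightarrow> 0 \<le> s \<and> s \<le> M"
  shows "(\<Sum>s\<in>#S. s\<^sup>2)
    \<le> \<epsilon>\<^sup>2 * real (size S) + M\<^sup>2 * real (size (filter_mset (\<lambda>s. s \<notin> {0..<\<epsilon>}) S))"
  using assms
proof (induction S)
  case (add s S)
  have s: "0 \<le> s" "s \<le> M" using add.prems by auto
  have IH: "(\<Sum>s\<in>#S. s\<^sup>2)
    \<le> \<epsilon>\<^sup>2 * real (size S) + M\<^sup>2 * real (size (filter_mset (\<lambda>s. s \<notin> {0..<\<epsilon>}) S))"
    using add by simp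
  show ?case
  proof (cases "s < \<epsilon>")
    case True
    hence "s\<^sup>2 \<le> \<epsilon>\<^sup>2" using s by (intro power_mono) auto
    hence "s\<^sup>2 + (\<Sum>s\<in>#S. s\<^sup>2) \<le> \<epsilon>\<^sup>2 + (\<epsilon>\<^sup>2 * real (size S)
        + M\<^sup>2 * real (size (filter_mset (\<lambda>s. s \<notin> {0..<\<epsilon>}) S)))"
      using IH by (intro add_mono)
    thus ?thesis using True s by (simp add: distrib_left)
  next
    case False
    have "s\<^sup>2 \<le> M\<^sup>2" using s by (intro power_mono) auto
    hence "s\<^sup>2 + (\<Sum>s\<in>#S. s\<^sup>2) \<le> \<epsilon>\<^sup>2 + M\<^sup>2 + (\<epsilon>\<^sup>2 * real (size S)
        + M\<^sup>2 * real (size (filter_mset (\<lambda>s. s \<notin> {0..<\<epsilon>}) S)))"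
      using IH by (intro add_mono) (auto intro: add_increasing)
    thus ?thesis using False by (simp add: distrib_left)
  qed
qed simp

text \<open>The number of outliers itself serves as the bound required by \<^const>\<open>weak_cluster\<close>: by Chebyshev's
  inequality it is at most \<open>\<parallel>X\<^sub>n - Y\<^sub>n\<parallel>\<^sub>F\<^sup>2 / \<epsilon>\<^sup>2 = o(n)\<close>.\<close>

lemma frob_small_imp_weak_cluster:
  assumes carrier: "\<And>n. n \<ge> 1 \<Longrightarrow> X n - Y n \<in> carrier_mat n n"
    and small: "frob_small (\<lambda>n. X n - Y n)"
  shows "weak_cluster X Y"
  unfolding weak_cluster_def
proof (intro allI impI)
  fix \<epsilon> :: real assume \<epsilon>: "\<epsilon> > 0"
  define N where "N = (\<lambda>n. size (filter_mset (\<lambda>s. s \<notin> {0..<\<epsilon>}) (singular_values (X n - Y n))))"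
  have "(\<lambda>n. real (N n)) \<in> o(\<lambda>n. real n)"
  proof (rule landau_o.smallI)
    fix c :: real assume c: "c > 0"
    from small[unfolded frob_small_iff, rule_format, of "\<epsilon> * sqrt c"] \<epsilon> c
    have "\<forall>\<^sub>F n in sequentially. frobenius_norm (X n - Y n) \<le> \<epsilon> * sqrt c * sqrt (real n)" by simp
    with eventually_ge_at_top[of 1]
    show "\<forall>\<^sub>F n in sequentially. norm (real (N n)) \<le> c * norm (real n)"
    proof eventually_elim
      case (elim n)
      note D = carrier[OF elim(1)]
      have "\<epsilon>\<^sup>2 * real (N n) \<le> (frobenius_norm (X n - Y n))\<^sup>2"
        unfolding N_def sum_singular_values_sq[OF D, symmetric]
        using \<epsilon> singular_values_nonneg[OF D] by (rule outliers_le_sum_sq)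
      also have "\<dots> \<le> (\<epsilon> * sqrt c * sqrt (real n))\<^sup>2"
        by (rule power_mono[OF elim(2) frobenius_norm_nonneg])
      also have "\<dots> = \<epsilon>\<^sup>2 * (c * real n)" using c by (simp add: power_mult_distrib)
      finally show ?case using \<epsilon> by simp
    qed
  qed
  thus "\<exists>N1 N2. (\<lambda>n. real (N1 n)) \<in> o(\<lambda>n. real n) \<and>
      (\<forall>n>N2. size (filter_mset (\<lambda>s. s \<notin> {0..<\<epsilon>}) (singular_values (X n - Y n))) \<le> N1 n)"
    by (intro exI[of _ N] exI[of _ 0]) (auto simp: N_def)
qed

text \<open>The converse needs the uniform operator bound: it caps what each of the \<open>o(n)\<close> outliers can
  contribute to the sum of squares.\<close>

lemma weak_cluster_imp_frob_small:
  assumes bounded: "\<And>n. n \<ge> 1 \<Longrightarrow> mult_bounded n (X n - Y n) M" and M: "0 \<le> M"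
    and wc: "weak_cluster X Y"
  shows "frob_small (\<lambda>n. X n - Y n)"
  unfolding frob_small_iff
proof (intro allI impI)
  fix \<delta> :: real assume \<delta>: "\<delta> > 0"
  obtain N1 N2 where o: "(\<lambda>n. real (N1 n)) \<in> o(\<lambda>n. real n)"
    and N: "\<And>n. n > N2 \<Longrightarrow>
      size (filter_mset (\<lambda>s. s \<notin> {0..<\<delta> / 2}) (singular_values (X n - Y n))) \<le> N1 n"
    using wc \<delta> unfolding weak_cluster_def by (meson half_gt_zero)
  \<comment> \<open>Small singular values and outliers each get half of \<open>\<delta>\<^sup>2 n\<close>; the \<open>+ 1\<close> covers \<open>M = 0\<close>.\<close>
  define c where "c = (\<delta> / 2)\<^sup>2 / (M\<^sup>2 + 1)"
  have M1: "M\<^sup>2 + 1 > 0" by (smt (verit) zero_le_power2)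
  have c: "c > 0" "M\<^sup>2 * c \<le> (\<delta> / 2)\<^sup>2"
    using \<delta> M1 by (auto simp: c_def divide_le_eq algebra_simps)
  from landau_o.smallD[OF o c(1)] eventually_gt_at_top[of N2] eventually_ge_at_top[of 1]
  show "\<forall>\<^sub>F n in sequentially. frobenius_norm (X n - Y n) \<le> \<delta> * sqrt (real n)"
  proof eventually_elim
    case (elim n)
    let ?S = "singular_values (X n - Y n)"
    note bd = bounded[OF elim(3)]
    hence D: "X n - Y n \<in> carrier_mat n n" by (simp add: mult_bounded_def)
    have "(frobenius_norm (X n - Y n))\<^sup>2
        \<le> (\<delta> / 2)\<^sup>2 * real (size ?S) + M\<^sup>2 * real (size (filter_mset (\<lambda>s. s \<notin> {0..<\<delta> / 2}) ?S))"
      unfolding sum_singular_values_sq[OF D, symmetric]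
      using singular_values_nonneg[OF D] singular_values_le[OF D bd M]
      by (intro sum_sq_le_outliers) auto
    also have "\<dots> \<le> (\<delta> / 2)\<^sup>2 * real n + M\<^sup>2 * (c * real n)"
      unfolding size_singular_values[OF D] using N[OF elim(2)] elim(1)
      by (intro add_left_mono mult_left_mono) auto
    also have "\<dots> \<le> (\<delta> / 2)\<^sup>2 * real n + (\<delta> / 2)\<^sup>2 * real n"
      using mult_right_mono[OF c(2), of "real n"] by (intro add_left_mono) (simp add: mult_ac)
    also have "\<dots> \<le> (\<delta> * sqrt (real n))\<^sup>2" by (simp add: power_mult_distrib power_divide)
    finally show ?case using \<delta> by (auto intro: power2_le_imp_le)
  qed
qed

section \<open>Periodic functions and trigonometric polynomials\<close>

lemma cont_periodicD:
  assumes "f \<in> cont_periodic"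
  shows "continuous_on UNIV f" "f (x + 2 * pi) = f x"
  using assms by (auto simp: cont_periodic_def)

text \<open>The factor is \<open>f \<circ> Arg\<close>. On the negative real axis, where \<^const>\<open>Arg\<close> jumps, periodicity allows
  replacing it by \<^const>\<open>Arg2pi\<close>, whose jump is on the positive axis. Compactness of the circle then
  gives boundedness and access to the Stone-Weierstrass theorem.\<close>

lemma cont_periodic_factors_through_circle:
  assumes f: "f \<in> cont_periodic"
  obtains F where "continuous_on (sphere 0 1) F" "\<And>x. f x = F (cis x)"
proof -
  interpret periodic_fun_simple f "2 * pi" by unfold_locales (rule cont_periodicD(2)[OF f])
  have same: "f x = f y" if "cis x = cis y" for x y
  proof -
    have "sin x = sin y \<and> cos x = cos y" using that by (auto simp: complex_eq_iff)
    then obtain k :: int where "x = y + 2 * pi * k" using sin_cos_eq_iff[of x y] by blast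
    thus ?thesis using plus_of_int[of y k] by (simp add: mult_ac)
  qed
  have cont: "continuous (at x) f" for x
    using cont_periodicD(1)[OF f] by (simp add: continuous_on_eq_continuous_at)
  have Arg2pi_eq: "f (Arg2pi z) = f (Arg z)" if "cmod z = 1" for z
  proof (rule same)
    have "z \<noteq> 0" using that by auto
    hence "cis (Arg z) = z" using that by (simp add: cis_Arg sgn_eq)
    moreover have "cis (Arg2pi z) = z" using Arg2pi_eq[of z] that by (simp add: cis_conv_exp)
    ultimately show "cis (Arg2pi z) = cis (Arg z)" by simp
  qed
  show thesis
  proof (rule that[of "\<lambda>z. f (Arg z)"])
    show "f x = f (Arg (cis x))" for x by (rule same) (simp add: cis_Arg sgn_eq)
    show "continuous_on (sphere 0 1) (\<lambda>z. f (Arg z))"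
      unfolding continuous_on_eq_continuous_within
    proof
      fix z :: complex assume z: "z \<in> sphere 0 1"
      show "continuous (at z within sphere 0 1) (\<lambda>z. f (Arg z))"
      proof (cases "z \<in> \<real>\<^sub>\<le>\<^sub>0")
        case False
        hence "continuous (at z) (\<lambda>z. f (Arg z))"
          using continuous_at_Arg cont by (intro isCont_o2[of z Arg f])
        thus ?thesis by (rule continuous_at_imp_continuous_at_within)
      next
        case True
        have "z \<notin> \<real>\<^sub>\<ge>\<^sub>0" using True z by (auto simp: complex_nonneg_Reals_iff complex_nonpos_Reals_iff cmod_def)
        hence "continuous (at z) (\<lambda>z. f (Arg2pi z))"
          using continuous_at_Arg2pi cont by (intro isCont_o2[of z Arg2pi f])
        hence "continuous (at z within sphere 0 1) (\<lambda>z. f (Arg2pi z))"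
          by (rule continuous_at_imp_continuous_at_within)
        thus ?thesis
          by (rule continuous_transform_within[of _ _ _ 1]) (use z in \<open>auto simp: Arg2pi_eq\<close>)
      qed
    qed
  qed
qed

lemma cont_periodic_bounded:
  assumes "f \<in> cont_periodic"
  obtains M where "0 \<le> M" "\<And>x. cmod (f x) \<le> M"
proof -
  obtain F where F: "continuous_on (sphere 0 1) F" "\<And>x. f x = F (cis x)"
    using cont_periodic_factors_through_circle[OF assms] by blast
  have "bounded (F ` sphere 0 1)"
    by (intro compact_imp_bounded compact_continuous_image F(1)) simp
  then obtain M where M: "\<And>z. z \<in> sphere 0 1 \<Longrightarrow> cmod (F z) \<le> M"
    unfolding bounded_iff by blast
  have bd: "cmod (f x) \<le> M" for x using M[of "cis x"] F(2)[of x] by simp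
  moreover have "0 \<le> M" using order_trans[OF norm_ge_zero bd] .
  ultimately show thesis using that by blast
qed

lemma cont_periodic_add: "f \<in> cont_periodic \<Longrightarrow> g \<in> cont_periodic \<Longrightarrow> (\<lambda>x. f x + g x) \<in> cont_periodic"
  and cont_periodic_diff: "f \<in> cont_periodic \<Longrightarrow> g \<in> cont_periodic \<Longrightarrow> (\<lambda>x. f x - g x) \<in> cont_periodic"
  and cont_periodic_mult: "f \<in> cont_periodic \<Longrightarrow> g \<in> cont_periodic \<Longrightarrow> (\<lambda>x. f x * g x) \<in> cont_periodic"
  and cont_periodic_cnj: "f \<in> cont_periodic \<Longrightarrow> (\<lambda>x. cnj (f x)) \<in> cont_periodic"
  and cont_periodic_const: "(\<lambda>x. c) \<in> cont_periodic"
  by (auto simp: cont_periodic_def intro!: continuous_intros)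

inductive trig_poly :: "(real \<Rightarrow> complex) \<Rightarrow> bool" where
  monomial: "trig_poly (\<lambda>x. c * cis (of_int k * x))"
| add: "trig_poly p \<Longrightarrow> trig_poly q \<Longrightarrow> trig_poly (\<lambda>x. p x + q x)"

lemma cis_monomial_cont_periodic: "(\<lambda>x. c * cis (of_int k * x)) \<in> cont_periodic"
proof -
  have "cis (of_int k * (x + 2 * pi)) = cis (of_int k * x)" for x
  proof -
    have "cis (of_int k * (x + 2 * pi)) = cis (of_int k * x) * cis (2 * pi * of_int k)"
      by (simp add: cis_mult algebra_simps)
    also have "cis (2 * pi * of_int k) = 1" by (simp add: complex_eq_iff)
    finally show ?thesis by simp
  qed
  thus ?thesis by (auto simp: cont_periodic_def intro!: continuous_intros)
qed

lemma trig_poly_cont_periodic: "trig_poly p \<Longrightarrow> p \<in> cont_periodic"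
  by (induction rule: trig_poly.induct) (auto intro: cis_monomial_cont_periodic cont_periodic_add)

lemma trig_poly_mult:
  assumes "trig_poly p" "trig_poly q"
  shows "trig_poly (\<lambda>x. p x * q x)"
  using assms
proof (induction arbitrary: q rule: trig_poly.induct)
  case (monomial c k)
  from monomial.prems show ?case
  proof (induction rule: trig_poly.induct)
    case (monomial d l)
    have eq: "c * cis (of_int k * x) * (d * cis (of_int l * x)) = (c * d) * cis (of_int (k + l) * x)" for x
    proof -
      have "cis (of_int k * x) * cis (of_int l * x) = cis (of_int (k + l) * x)"
        by (simp add: cis_mult distrib_right)
      thus ?thesis by (simp add: mult_ac)
    qed
    show ?case unfolding eq by (rule trig_poly.monomial)
  next
    case (add p q)
    thus ?case using trig_poly.add by (simp add: distrib_left)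
  qed
next
  case (add p q)
  show ?case using trig_poly.add[OF add.IH(1) add.IH(2), OF add.prems add.prems]
    by (simp add: distrib_right)
qed

lemma trig_poly_const: "trig_poly (\<lambda>x. c)"
  using trig_poly.monomial[of c 0] by simp

lemma real_polynomial_on_circle_trig_poly:
  assumes "real_polynomial_function (h :: complex \<Rightarrow> real)"
  shows "trig_poly (\<lambda>x. complex_of_real (h (cis x)))"
  using assms
proof (induction rule: real_polynomial_function.induct)
  case (linear h)
  interpret bounded_linear h by fact
  \<comment> \<open>A real linear form on the circle is \<open>\<alpha> cos x + \<beta> sin x\<close>, rewritten by Euler's formulas.\<close>
  define a where "a = (complex_of_real (h 1) - \<i> * of_real (h \<i>)) / 2"
  define b where "b = (complex_of_real (h 1) + \<i> * of_real (h \<i>)) / 2"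
  have "h (cis x) = cos x * h 1 + sin x * h \<i>" for x
  proof -
    have "cis x = cos x *\<^sub>R 1 + sin x *\<^sub>R \<i>" by (simp add: complex_eq_iff)
    thus ?thesis by (simp only: add scaleR real_scaleR_def)
  qed
  hence "complex_of_real (h (cis x)) = a * cis (of_int 1 * x) + b * cis (of_int (- 1) * x)" for x
    by (simp add: a_def b_def complex_eq_iff) (simp add: field_simps)
  thus ?case using trig_poly.add[OF trig_poly.monomial[of a 1] trig_poly.monomial[of b "- 1"]] by simp
next
  case (const c)
  show ?case by (rule trig_poly_const)
next
  case (add f g)
  thus ?case using trig_poly.add by simp
next
  case (mult f g)
  thus ?case using trig_poly_mult by simp
qed

lemma trig_poly_dense:
  assumes f: "f \<in> cont_periodic" and \<epsilon>: "\<epsilon> > 0"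
  obtains p where "trig_poly p" "\<And>x. cmod (f x - p x) \<le> \<epsilon>"
proof -
  obtain F where F: "continuous_on (sphere 0 1) F" "\<And>x. f x = F (cis x)"
    using cont_periodic_factors_through_circle[OF f] by blast
  have cont: "continuous_on (sphere 0 1) (\<lambda>z. Re (F z))" "continuous_on (sphere 0 1) (\<lambda>z. Im (F z))"
    by (intro continuous_intros F(1))+
  have e2: "\<epsilon> / 2 > 0" using \<epsilon> by simp
  obtain g where g: "real_polynomial_function g" "\<And>z. z \<in> sphere 0 1 \<Longrightarrow> \<bar>Re (F z) - g z\<bar> < \<epsilon> / 2"
    using Stone_Weierstrass_real_polynomial_function[OF compact_sphere cont(1) e2] by blast
  obtain h where h: "real_polynomial_function h" "\<And>z. z \<in> sphere 0 1 \<Longrightarrow> \<bar>Im (F z) - h z\<bar> < \<epsilon> / 2"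
    using Stone_Weierstrass_real_polynomial_function[OF compact_sphere cont(2) e2] by blast
  define p where "p = (\<lambda>x. complex_of_real (g (cis x)) + \<i> * complex_of_real (h (cis x)))"
  have "trig_poly p" unfolding p_def
    by (intro trig_poly.add trig_poly_mult trig_poly_const real_polynomial_on_circle_trig_poly g(1) h(1))
  moreover have "cmod (f x - p x) \<le> \<epsilon>" for x
  proof -
    have "cmod (f x - p x) \<le> \<bar>Re (f x - p x)\<bar> + \<bar>Im (f x - p x)\<bar>" by (rule cmod_le)
    also have "\<dots> \<le> \<epsilon>" using g(2)[of "cis x"] h(2)[of "cis x"] by (simp add: p_def F(2))
    finally show ?thesis .
  qed
  ultimately show thesis by (rule that)
qed

section \<open>Fourier coefficients and the Toeplitz form\<close>

lemma fourier_coeff_cis: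
  "fourier_coeff f k = 1 / (2 * of_real pi) * integral {0..2 * pi} (\<lambda>x. f x * cis (- of_int k * x))"
  by (simp add: fourier_coeff_def cis_conv_exp mult_ac)

lemma periodic_integrable:
  assumes "f \<in> cont_periodic"
  shows "f integrable_on {0..2 * pi}"
  using cont_periodicD(1)[OF assms] by (intro integrable_continuous_interval) (auto intro: continuous_on_subset)

lemma fourier_integrand_integrable:
  assumes "f \<in> cont_periodic"
  shows "(\<lambda>x. f x * cis (- of_int k * x)) integrable_on {0..2 * pi}"
  using cont_periodic_mult[OF assms cis_monomial_cont_periodic[of 1 "- k"]]
  by (intro periodic_integrable) simp

lemma
  assumes "f \<in> cont_periodic" "g \<in> cont_periodic"
  shows fourier_coeff_add: "fourier_coeff (\<lambda>x. f x + g x) k = fourier_coeff f k + fourier_coeff g k"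
    and fourier_coeff_diff: "fourier_coeff (\<lambda>x. f x - g x) k = fourier_coeff f k - fourier_coeff g k"
  using assms fourier_integrand_integrable
  by (auto simp: fourier_coeff_cis distrib_right left_diff_distrib integral_add integral_diff
      distrib_left right_diff_distrib)

lemma fourier_coeff_cnj: "fourier_coeff (\<lambda>x. cnj (f x)) k = cnj (fourier_coeff f (- k))"
  by (simp add: fourier_coeff_cis integral_cnj cis_cnj)

lemma fourier_coeff_mult_monomial:
  "fourier_coeff (\<lambda>x. f x * (c * cis (of_int l * x))) k = c * fourier_coeff f (k - l)"
proof -
  have eq: "f x * (c * cis (of_int l * x)) * cis (- of_int k * x) = c * (f x * cis (- of_int (k - l) * x))" for x
  proof -
    have "cis (of_int l * x) * cis (- of_int k * x) = cis (- of_int (k - l) * x)"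
      by (simp add: cis_mult algebra_simps)
    thus ?thesis by (simp add: mult_ac)
  qed
  show ?thesis unfolding fourier_coeff_cis eq by simp
qed

lemma fourier_coeff_const: "fourier_coeff (\<lambda>x. c) k = (if k = 0 then c else 0)"
proof (cases "k = 0")
  case True
  thus ?thesis by (simp add: fourier_coeff_cis scaleR_conv_of_real)
next
  case False
  define F where "F = (\<lambda>x::real. c * (cis (- of_int k * x) / (- \<i> * of_int k)))"
  have I: "((\<lambda>x. c * cis (- of_int k * x)) has_integral F (2 * pi) - F 0) {0..2 * pi}"
  proof (rule fundamental_theorem_of_calculus)
    fix x :: real
    show "(F has_vector_derivative c * cis (- of_int k * x)) (at x within {0..2 * pi})"
      unfolding F_def cis_conv_exp using False
      by (auto intro!: derivative_eq_intros has_vector_derivative_real_field simp: mult_ac)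
  qed simp
  have "cis (- of_int k * (2 * pi)) = 1"
    by (simp add: complex_eq_iff mult.commute[of _ "2 * pi"])
  hence "F (2 * pi) = F 0" by (simp add: F_def)
  hence "integral {0..2 * pi} (\<lambda>x. c * cis (- of_int k * x)) = 0"
    using integral_unique[OF I] by simp
  thus ?thesis using False by (simp add: fourier_coeff_cis)
qed

lemma fourier_coeff_monomial:
  "fourier_coeff (\<lambda>x. c * cis (of_int l * x)) k = (if k = l then c else 0)"
  using fourier_coeff_mult_monomial[of "\<lambda>x. 1" c l k] by (simp add: fourier_coeff_const)

definition trig_sum :: "nat \<Rightarrow> (nat \<Rightarrow> complex) \<Rightarrow> real \<Rightarrow> complex" where
  "trig_sum n v x = (\<Sum>k<n. v k * cis (real k * x))"

lemma trig_sum_cont_periodic: "trig_sum n v \<in> cont_periodic"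
proof (induction n)
  case 0
  show ?case using cont_periodic_const[of 0] by (simp add: trig_sum_def[abs_def])
next
  case (Suc n)
  thus ?case
    using cont_periodic_add[OF Suc cis_monomial_cont_periodic[of "v n" "int n"]]
    by (simp add: trig_sum_def[abs_def])
qed

text \<open>The sesquilinear form of a Toeplitz matrix is the integral of the symbol against a product of
  trigonometric polynomials. With symbol 1 this is Parseval's identity.\<close>

lemma toeplitz_form_integral:
  assumes f: "f \<in> cont_periodic"
  shows "(\<Sum>j<n. \<Sum>k<n. cnj (w j) * fourier_coeff f (int j - int k) * v k)
    = 1 / (2 * of_real pi) * integral {0..2 * pi} (\<lambda>x. f x * (cnj (trig_sum n w x) * trig_sum n v x))"
proof -
  have expand: "f x * (cnj (trig_sum n w x) * trig_sum n v x)
      = (\<Sum>j<n. \<Sum>k<n. (cnj (w j) * v k) * (f x * cis (- of_int (int j - int k) * x)))" for x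
  proof -
    have "cis (- of_int (int j - int k) * x) = cnj (cis (real j * x)) * cis (real k * x)" for j k
      by (simp add: cis_cnj cis_mult algebra_simps)
    thus ?thesis
      by (simp add: trig_sum_def sum_product sum_distrib_left mult_ac del: of_int_diff)
  qed
  have "integral {0..2 * pi} (\<lambda>x. f x * (cnj (trig_sum n w x) * trig_sum n v x))
      = (\<Sum>j<n. \<Sum>k<n. (cnj (w j) * v k) * integral {0..2 * pi} (\<lambda>x. f x * cis (- of_int (int j - int k) * x)))"
    unfolding expand using fourier_integrand_integrable[OF f]
    by (simp add: integral_sum integrable_sum integrable_on_mult_right del: of_int_diff)
  thus ?thesis
    by (simp add: fourier_coeff_cis sum_distrib_left mult_ac del: of_int_diff)
qed

lemma trig_sum_parseval:
  "integral {0..2 * pi} (\<lambda>x. (cmod (trig_sum n v x))\<^sup>2) = 2 * pi * (\<Sum>k<n. (cmod (v k))\<^sup>2)"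
proof -
  let ?g = "\<lambda>x. (cmod (trig_sum n v x))\<^sup>2"
  have cont: "continuous_on {0..2 * pi} (trig_sum n v)"
    using cont_periodicD(1)[OF trig_sum_cont_periodic] by (rule continuous_on_subset) simp
  have "complex_of_real (\<Sum>k<n. (cmod (v k))\<^sup>2)
      = (\<Sum>j<n. \<Sum>k<n. cnj (v j) * fourier_coeff (\<lambda>x. 1) (int j - int k) * v k)"
  proof -
    have "(\<Sum>k<n. cnj (v j) * fourier_coeff (\<lambda>x. 1) (int j - int k) * v k)
        = complex_of_real ((cmod (v j))\<^sup>2)" if "j < n" for j
    proof -
      have "(\<Sum>k<n. cnj (v j) * fourier_coeff (\<lambda>x. 1) (int j - int k) * v k)
          = (\<Sum>k<n. if j = k then cnj (v j) * v k else 0)"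
        by (intro sum.cong refl) (simp add: fourier_coeff_const)
      also have "\<dots> = cnj (v j) * v j" using that by simp
      finally show ?thesis unfolding complex_norm_square by (simp add: mult.commute)
    qed
    thus ?thesis by simp
  qed
  also have "\<dots> = 1 / (2 * of_real pi) * integral {0..2 * pi} (\<lambda>x. complex_of_real (?g x))"
    unfolding toeplitz_form_integral[OF cont_periodic_const] complex_norm_square by (simp add: mult.commute)
  also have "integral {0..2 * pi} (\<lambda>x. complex_of_real (?g x)) = of_real (integral {0..2 * pi} ?g)"
    by (intro integral_unique has_integral_of_real integrable_integral integrable_continuous_interval
        continuous_intros cont)
  finally have "complex_of_real (\<Sum>k<n. (cmod (v k))\<^sup>2) = of_real (1 / (2 * pi) * integral {0..2 * pi} ?g)"
    by simp
  hence "(\<Sum>k<n. (cmod (v k))\<^sup>2) = 1 / (2 * pi) * integral {0..2 * pi} ?g" unfolding of_real_eq_iff .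
  thus ?thesis by simp
qed

lemma toeplitz_form_bound:
  assumes f: "f \<in> cont_periodic" and M: "\<And>x. cmod (f x) \<le> M"
  shows "cmod (\<Sum>j<n. \<Sum>k<n. cnj (w j) * fourier_coeff f (int j - int k) * v k)
    \<le> M / 2 * ((\<Sum>k<n. (cmod (w k))\<^sup>2) + (\<Sum>k<n. (cmod (v k))\<^sup>2))"
proof -
  let ?w = "trig_sum n w" and ?v = "trig_sum n v"
  have cont: "continuous_on {0..2 * pi} (trig_sum n u)" for u
    using cont_periodicD(1)[OF trig_sum_cont_periodic] by (rule continuous_on_subset) simp
  have "cmod (integral {0..2 * pi} (\<lambda>x. f x * (cnj (?w x) * ?v x)))
      \<le> integral {0..2 * pi} (\<lambda>x. M / 2 * ((cmod (?w x))\<^sup>2 + (cmod (?v x))\<^sup>2))"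
  proof (rule integral_norm_bound_integral)
    show "(\<lambda>x. f x * (cnj (?w x) * ?v x)) integrable_on {0..2 * pi}"
      by (intro periodic_integrable cont_periodic_mult cont_periodic_cnj trig_sum_cont_periodic f)
    show "(\<lambda>x. M / 2 * ((cmod (?w x))\<^sup>2 + (cmod (?v x))\<^sup>2)) integrable_on {0..2 * pi}"
      by (intro integrable_continuous_interval continuous_intros cont)
    fix x
    have "2 * (cmod (?w x) * cmod (?v x)) \<le> (cmod (?w x))\<^sup>2 + (cmod (?v x))\<^sup>2"
      using sum_squares_bound[of "cmod (?w x)" "cmod (?v x)"] by simp
    hence "cmod (?w x) * cmod (?v x) \<le> ((cmod (?w x))\<^sup>2 + (cmod (?v x))\<^sup>2) / 2" by simp
    hence "cmod (f x) * (cmod (?w x) * cmod (?v x)) \<le> M * (((cmod (?w x))\<^sup>2 + (cmod (?v x))\<^sup>2) / 2)"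
      using M[of x] order_trans[OF norm_ge_zero M[of x]] by (intro mult_mono) auto
    thus "cmod (f x * (cnj (?w x) * ?v x)) \<le> M / 2 * ((cmod (?w x))\<^sup>2 + (cmod (?v x))\<^sup>2)"
      by (simp add: norm_mult)
  qed
  also have "\<dots> = M / 2 * (2 * pi * (\<Sum>k<n. (cmod (w k))\<^sup>2) + 2 * pi * (\<Sum>k<n. (cmod (v k))\<^sup>2))"
  proof -
    have "(\<lambda>x. (cmod (trig_sum n u x))\<^sup>2) integrable_on {0..2 * pi}" for u
      by (intro integrable_continuous_interval continuous_intros cont)
    thus ?thesis by (simp only: integral_mult_right integral_add trig_sum_parseval)
  qed
  finally have "cmod (integral {0..2 * pi} (\<lambda>x. f x * (cnj (?w x) * ?v x)))
      \<le> 2 * pi * (M / 2 * ((\<Sum>k<n. (cmod (w k))\<^sup>2) + (\<Sum>k<n. (cmod (v k))\<^sup>2)))"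
    by (simp add: algebra_simps)
  thus ?thesis unfolding toeplitz_form_integral[OF f] norm_mult
    by (simp add: norm_divide pos_divide_le_eq mult.commute)
qed

section \<open>Norm bounds for Toeplitz matrices\<close>

lemma toeplitz_carrier [simp]: "toeplitz f n \<in> carrier_mat n n"
  by (simp add: toeplitz_def)

lemma toeplitz_adjoint: "mat_adjoint (toeplitz f n) = toeplitz (\<lambda>x. cnj (f x)) n"
proof (rule eq_matI)
  fix i j assume "i < dim_row (toeplitz (\<lambda>x. cnj (f x)) n)" "j < dim_col (toeplitz (\<lambda>x. cnj (f x)) n)"
  hence ij: "i < n" "j < n" by (auto simp: toeplitz_def)
  show "mat_adjoint (toeplitz f n) $$ (i, j) = toeplitz (\<lambda>x. cnj (f x)) n $$ (i, j)"
    unfolding index_mat_adjoint[OF toeplitz_carrier ij]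
    using ij by (simp add: toeplitz_def fourier_coeff_cnj)
qed (use mat_adjoint_carrier[OF toeplitz_carrier[of f n]] in \<open>auto simp: toeplitz_def\<close>)

lemma toeplitz_diff:
  assumes "f \<in> cont_periodic" "g \<in> cont_periodic"
  shows "toeplitz (\<lambda>x. f x - g x) n = toeplitz f n - toeplitz g n"
  by (rule eq_matI) (auto simp: toeplitz_def fourier_coeff_diff[OF assms])

lemma toeplitz_add:
  assumes "f \<in> cont_periodic" "g \<in> cont_periodic"
  shows "toeplitz (\<lambda>x. f x + g x) n = toeplitz f n + toeplitz g n"
  by (rule eq_matI) (auto simp: toeplitz_def fourier_coeff_add[OF assms])

lemma toeplitz_const: "toeplitz (\<lambda>x. c) n = c \<cdot>\<^sub>m 1\<^sub>m n"
  by (rule eq_matI) (auto simp: toeplitz_def fourier_coeff_const)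

text \<open>The bound on the sesquilinear form, applied to \<open>w = t T Z\<close> column by column, gives
  \<open>t r \<le> M/2 (t\<^sup>2 r + s)\<close> for \<open>r = \<parallel>T Z\<parallel>\<^sup>2\<close> and \<open>s = \<parallel>Z\<parallel>\<^sup>2\<close>; for \<open>M > 0\<close> the scaling \<open>t = 1/M\<close> turns this
  into \<open>r \<le> M\<^sup>2 s\<close>.\<close>

lemma toeplitz_mult_bounded:
  assumes f: "f \<in> cont_periodic" and M: "\<And>x. cmod (f x) \<le> M"
  shows "mult_bounded n (toeplitz f n) M"
  unfolding mult_bounded_def
proof (intro conjI ballI toeplitz_carrier)
  fix Z :: "complex mat" assume Z: "Z \<in> carrier_mat n n"
  define W where "W = toeplitz f n * Z"
  have W: "W \<in> carrier_mat n n"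
    unfolding W_def by (rule mult_carrier_mat[OF toeplitz_carrier Z])
  define r where "r = (frobenius_norm W)\<^sup>2"
  define s where "s = (frobenius_norm Z)\<^sup>2"
  have M0: "0 \<le> M" using order_trans[OF norm_ge_zero M[of 0]] .
  have form: "t * r \<le> M / 2 * (t\<^sup>2 * r + s)" if t: "t > 0" for t
  proof -
    have col: "t * (\<Sum>j<n. (cmod (W $$ (j, c)))\<^sup>2)
        \<le> M / 2 * (t\<^sup>2 * (\<Sum>j<n. (cmod (W $$ (j, c)))\<^sup>2) + (\<Sum>j<n. (cmod (Z $$ (j, c)))\<^sup>2))"
      if c: "c < n" for c
    proof -
      have W_entry: "W $$ (j, c) = (\<Sum>k<n. fourier_coeff f (int j - int k) * Z $$ (k, c))" if "j < n" for j
        unfolding W_def mult_entry[OF toeplitz_carrier Z that c] using that by (simp add: toeplitz_def)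
      have "(\<Sum>j<n. \<Sum>k<n. cnj (of_real t * W $$ (j, c)) * fourier_coeff f (int j - int k) * Z $$ (k, c))
          = (\<Sum>j<n. of_real t * (cnj (W $$ (j, c)) * W $$ (j, c)))"
      proof (rule sum.cong)
        fix j assume "j \<in> {..<n}"
        hence W_jc: "(\<Sum>k<n. fourier_coeff f (int j - int k) * Z $$ (k, c)) = W $$ (j, c)"
          by (simp add: W_entry)
        have "(\<Sum>k<n. cnj (of_real t * W $$ (j, c)) * fourier_coeff f (int j - int k) * Z $$ (k, c))
            = cnj (of_real t * W $$ (j, c)) * W $$ (j, c)"
          unfolding mult.assoc sum_distrib_left[symmetric] W_jc ..
        thus "(\<Sum>k<n. cnj (of_real t * W $$ (j, c)) * fourier_coeff f (int j - int k) * Z $$ (k, c))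
            = of_real t * (cnj (W $$ (j, c)) * W $$ (j, c))" by simp
      qed simp
      also have "\<dots> = of_real (t * (\<Sum>j<n. (cmod (W $$ (j, c)))\<^sup>2))"
        unfolding of_real_mult of_real_sum complex_norm_square by (simp add: sum_distrib_left mult.commute)
      finally have "cmod (of_real (t * (\<Sum>j<n. (cmod (W $$ (j, c)))\<^sup>2)))
          \<le> M / 2 * ((\<Sum>j<n. (cmod (of_real t * W $$ (j, c)))\<^sup>2) + (\<Sum>j<n. (cmod (Z $$ (j, c)))\<^sup>2))"
        using toeplitz_form_bound[OF f M, where n = n and w = "\<lambda>j. of_real t * W $$ (j, c)"
            and v = "\<lambda>k. Z $$ (k, c)"] by simp
      moreover have "0 \<le> t * (\<Sum>j<n. (cmod (W $$ (j, c)))\<^sup>2)"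
        using t by (intro mult_nonneg_nonneg sum_nonneg) auto
      ultimately show ?thesis
        unfolding norm_of_real by (simp add: norm_mult power_mult_distrib sum_distrib_left)
    qed
    have frob: "(frobenius_norm A)\<^sup>2 = (\<Sum>c<n. \<Sum>j<n. (cmod (A $$ (j, c)))\<^sup>2)" if "A \<in> carrier_mat n n" for A
      unfolding frobenius_norm_sq[OF that] by (rule sum.swap)
    have "t * r = (\<Sum>c<n. t * (\<Sum>j<n. (cmod (W $$ (j, c)))\<^sup>2))"
      by (simp add: r_def frob[OF W] sum_distrib_left)
    also have "\<dots> \<le> (\<Sum>c<n. M / 2 * (t\<^sup>2 * (\<Sum>j<n. (cmod (W $$ (j, c)))\<^sup>2) + (\<Sum>j<n. (cmod (Z $$ (j, c)))\<^sup>2)))"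
      by (intro sum_mono col) simp
    also have "\<dots> = M / 2 * (t\<^sup>2 * r + s)"
      unfolding r_def s_def frob[OF W] frob[OF Z]
      by (simp only: sum_distrib_left[symmetric] sum.distrib)
    finally show ?thesis .
  qed
  have "r \<le> M\<^sup>2 * s"
  proof (cases "M = 0")
    case True
    thus ?thesis using form[of 1] by (simp add: r_def)
  next
    case False
    hence "M > 0" using M0 by simp
    thus ?thesis using form[of "1 / M"] by (simp add: field_simps power2_eq_square)
  qed
  hence "(frobenius_norm W)\<^sup>2 \<le> (M * frobenius_norm Z)\<^sup>2" by (simp add: r_def s_def power_mult_distrib)
  thus "frobenius_norm (toeplitz f n * Z) \<le> M * frobenius_norm Z"
    unfolding W_def by (rule power2_le_imp_le) (simp add: M0 frobenius_norm_nonneg)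
qed

lemma frobenius_norm_one: "frobenius_norm (1\<^sub>m n) = sqrt (real n)"
  by (simp add: frobenius_norm_def if_distrib[of "\<lambda>t. (cmod t)\<^sup>2"] cong: if_cong)

lemma frobenius_norm_toeplitz_le:
  assumes "f \<in> cont_periodic" "\<And>x. cmod (f x) \<le> M"
  shows "frobenius_norm (toeplitz f n) \<le> M * sqrt (real n)"
  using toeplitz_mult_bounded[OF assms, of n] frobenius_norm_one[of n]
    right_mult_one_mat[OF toeplitz_carrier[of f n]]
  by (auto simp: mult_bounded_def dest!: bspec[of _ _ "1\<^sub>m n"])

section \<open>Asymptotic multiplicativity of Toeplitz matrices\<close>

text \<open>The matrix \<open>A\<^sub>n(e\<^sup>i\<^sup>k\<^sup>x)\<close> is a shift by \<open>k\<close>. Multiplying by it reproduces every column of \<open>A\<^sub>n(f e\<^sup>i\<^sup>k\<^sup>x)\<close>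
  except the at most \<open>\<bar>k\<bar>\<close> ones whose shifted index leaves \<open>{0..<n}\<close>; those are missing entirely. The
  difference is therefore \<open>A\<^sub>n(f e\<^sup>i\<^sup>k\<^sup>x)\<close> times the coordinate projection \<open>R\<close> onto the bad columns.\<close>

lemma toeplitz_mult_monomial:
  fixes c :: complex and k :: int
  assumes f: "f \<in> cont_periodic" and M: "\<And>x. cmod (f x) \<le> M"
  defines "g \<equiv> \<lambda>x. c * cis (of_int k * x)"
  shows "frobenius_norm (toeplitz (\<lambda>x. f x * g x) n - toeplitz f n * toeplitz g n)
    \<le> M * cmod c * sqrt \<bar>real_of_int k\<bar>"
proof -
  define bad where "bad = {l. l < n \<and> \<not> (0 \<le> int l + k \<and> int l + k < int n)}"
  define R where "R = mat n n (\<lambda>(i, l). if i = l \<and> l \<in> bad then 1 else (0 :: complex))"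
  have R: "R \<in> carrier_mat n n" by (simp add: R_def)
  have fg: "(\<lambda>x. f x * g x) \<in> cont_periodic"
    unfolding g_def by (intro cont_periodic_mult f cis_monomial_cont_periodic)
  have fg_le: "cmod (f x * g x) \<le> M * cmod c" for x
    using M[of x] by (simp add: g_def norm_mult mult_right_mono)
  have M0: "0 \<le> M" using order_trans[OF norm_ge_zero M[of 0]] .
  have "toeplitz (\<lambda>x. f x * g x) n - toeplitz f n * toeplitz g n = toeplitz (\<lambda>x. f x * g x) n * R"
    (is "?L = ?R")
  proof (rule eq_matI)
    fix j l assume "j < dim_row ?R" "l < dim_col ?R"
    hence jl: "j < n" "l < n" by (auto simp: toeplitz_def R_def)
    have fg_entry: "toeplitz (\<lambda>x. f x * g x) n $$ (j, l) = c * fourier_coeff f (int j - int l - k)"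
      using jl by (simp add: toeplitz_def g_def fourier_coeff_mult_monomial)
    have "(toeplitz f n * toeplitz g n) $$ (j, l)
        = (\<Sum>i<n. if int i = int l + k then c * fourier_coeff f (int j - int i) else 0)"
      unfolding mult_entry[OF toeplitz_carrier toeplitz_carrier jl] using jl
      by (intro sum.cong refl) (auto simp: toeplitz_def g_def fourier_coeff_monomial)
    also have "\<dots> = (if l \<in> bad then 0 else c * fourier_coeff f (int j - int l - k))"
    proof (cases "l \<in> bad")
      case True
      hence "int i \<noteq> int l + k" if "i < n" for i using that jl by (auto simp: bad_def)
      thus ?thesis using True by simp
    next
      case False
      define i0 where "i0 = nat (int l + k)"
      have i0: "i0 < n" "int i0 = int l + k" using False jl by (auto simp: bad_def i0_def)
      have "(\<Sum>i<n. if int i = int l + k then c * fourier_coeff f (int j - int i) else 0)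
          = (\<Sum>i<n. if i0 = i then c * fourier_coeff f (int j - int i) else 0)"
        by (intro sum.cong refl) (simp add: i0(2)[symmetric] eq_commute)
      thus ?thesis using False i0 by (simp add: algebra_simps)
    qed
    finally have prod_entry: "(toeplitz f n * toeplitz g n) $$ (j, l)
        = (if l \<in> bad then 0 else c * fourier_coeff f (int j - int l - k))" .
    have "?R $$ (j, l) = (\<Sum>i<n. if i = l then (if l \<in> bad then toeplitz (\<lambda>x. f x * g x) n $$ (j, l) else 0) else 0)"
      unfolding mult_entry[OF toeplitz_carrier R jl] using jl
      by (intro sum.cong refl) (auto simp: R_def)
    also have "\<dots> = (if l \<in> bad then c * fourier_coeff f (int j - int l - k) else 0)"
      using jl by (simp add: fg_entry)
    finally show "?L $$ (j, l) = ?R $$ (j, l)"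
      using jl prod_entry fg_entry carrier_matD[OF toeplitz_carrier[of f n]] carrier_matD[OF toeplitz_carrier[of g n]]
      by (simp del: index_mult_mat(1))
  qed (simp_all add: toeplitz_def R_def)
  hence "frobenius_norm ?L \<le> M * cmod c * frobenius_norm R"
    using toeplitz_mult_bounded[OF fg fg_le, of n] R by (simp add: mult_bounded_def)
  also have "frobenius_norm R \<le> sqrt \<bar>real_of_int k\<bar>"
  proof -
    have "(\<Sum>i<n. \<Sum>l<n. (cmod (R $$ (i, l)))\<^sup>2) = (\<Sum>i<n. if i \<in> bad then 1 else 0)"
    proof (intro sum.cong refl)
      fix i assume i: "i \<in> {..<n}"
      have "(\<Sum>l<n. (cmod (R $$ (i, l)))\<^sup>2) = (\<Sum>l<n. if i = l then (if i \<in> bad then 1 else 0) else 0)"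
        using i by (intro sum.cong refl) (auto simp: R_def)
      thus "(\<Sum>l<n. (cmod (R $$ (i, l)))\<^sup>2) = (if i \<in> bad then 1 else 0)" using i by simp
    qed
    also have "\<dots> = real (card bad)"
    proof -
      have "{..<n} \<inter> bad = bad" by (auto simp: bad_def)
      thus ?thesis by (simp flip: sum.inter_restrict)
    qed
    finally have "(frobenius_norm R)\<^sup>2 = real (card bad)" by (simp add: frobenius_norm_sq[OF R])
    moreover have "card bad \<le> nat \<bar>k\<bar>"
    proof (cases "k \<ge> 0")
      case True
      have "bad \<subseteq> {n - nat k..<n}" using True by (auto simp: bad_def)
      hence "card bad \<le> card {n - nat k..<n}" by (intro card_mono) auto
      thus ?thesis using True by simp
    next
      case False
      have "bad \<subseteq> {..<nat (- k)}" using False by (auto simp: bad_def)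
      hence "card bad \<le> card {..<nat (- k)}" by (intro card_mono) auto
      thus ?thesis using False by simp
    qed
    ultimately have "(frobenius_norm R)\<^sup>2 \<le> \<bar>real_of_int k\<bar>" by linarith
    thus ?thesis by (rule real_le_rsqrt)
  qed
  finally show ?thesis using M0 by (simp add: mult_left_mono)
qed

text \<open>Trigonometric polynomials \<open>p\<close> are settled by \<open>toeplitz_mult_monomial\<close>, where the error even stays
  bounded. Replacing \<open>g\<close> by a uniformly close \<open>p\<close> changes each of the two terms by at most
  \<open>sup \<bar>f\<bar> sup \<bar>g - p\<bar> \<surd>n\<close>.\<close>

lemma toeplitz_mult_asymptotic:
  assumes f: "f \<in> cont_periodic" and g: "g \<in> cont_periodic"
  shows "frob_small (\<lambda>n. toeplitz (\<lambda>x. f x * g x) n - toeplitz f n * toeplitz g n)"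
    (is "frob_small (?D g)")
proof (rule frob_small_approx)
  obtain M where M: "0 \<le> M" "\<And>x. cmod (f x) \<le> M" using cont_periodic_bounded[OF f] by blast
  have T: "toeplitz f n * toeplitz h n \<in> carrier_mat n n" for n h
    by (rule mult_carrier_mat[OF toeplitz_carrier toeplitz_carrier])
  have trig: "frob_small (?D p)" if "trig_poly p" for p
    using that
  proof (induction rule: trig_poly.induct)
    case (monomial c k)
    let ?C = "M * cmod c * sqrt \<bar>real_of_int k\<bar>"
    have "(\<lambda>n. ?C) \<in> o(\<lambda>n. sqrt (real n))" by real_asymp
    moreover have "(\<lambda>n. frobenius_norm (?D (\<lambda>x. c * cis (of_int k * x)) n)) \<in> O(\<lambda>n. ?C)"
      using toeplitz_mult_monomial[OF f M(2)] M(1)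
      by (intro bigoI[of _ 1] always_eventually allI) (simp add: frobenius_norm_nonneg)
    ultimately show ?case unfolding frob_small_def by (rule landau_o.big_small_trans[rotated])
  next
    case (add p q)
    note pq = trig_poly_cont_periodic[OF add.hyps(1)] trig_poly_cont_periodic[OF add.hyps(2)]
    have "?D (\<lambda>x. p x + q x) n = ?D p n + ?D q n" for n
    proof -
      have "toeplitz (\<lambda>x. f x * (p x + q x)) n
          = toeplitz (\<lambda>x. f x * p x) n + toeplitz (\<lambda>x. f x * q x) n"
        unfolding distrib_left using pq f by (intro toeplitz_add cont_periodic_mult)
      moreover have "toeplitz f n * toeplitz (\<lambda>x. p x + q x) n
          = toeplitz f n * toeplitz p n + toeplitz f n * toeplitz q n"
        unfolding toeplitz_add[OF pq] by (rule mult_add_distrib_mat) (rule toeplitz_carrier)+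
      moreover have "(A + B) - (C + D) = (A - C) + (B - D)"
        if "A \<in> carrier_mat n n" "B \<in> carrier_mat n n" "C \<in> carrier_mat n n" "D \<in> carrier_mat n n"
        for A B C D :: "complex mat"
        using that by (intro eq_matI) auto
      ultimately show ?thesis using T by simp
    qed
    moreover have "?D h n \<in> carrier_mat n n" for h n by (rule minus_carrier_mat[OF T])
    ultimately show ?case
      by (intro frob_small_triangle[OF add.IH, of _ 1 1])
        (auto intro!: always_eventually frobenius_norm_triangle)
  qed
  fix \<epsilon> :: real assume \<epsilon>: "\<epsilon> > 0"
  \<comment> \<open>The approximation enters twice, each time multiplied by \<open>M\<close>; the \<open>+ 1\<close> covers \<open>M = 0\<close>.\<close>
  define \<delta> where "\<delta> = \<epsilon> / (2 * (M + 1))"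
  have \<delta>: "\<delta> > 0" using \<epsilon> M(1) by (simp add: \<delta>_def)
  have M\<delta>: "2 * (M * \<delta>) \<le> \<epsilon>" using \<epsilon> M(1) by (simp add: \<delta>_def field_simps)
  obtain p where p: "trig_poly p" "\<And>x. cmod (g x - p x) \<le> \<delta>" using trig_poly_dense[OF g \<delta>] by blast
  note pc = trig_poly_cont_periodic[OF p(1)]
  have "frobenius_norm (?D g n) \<le> frobenius_norm (?D p n) + \<epsilon> * sqrt (real n)" for n
  proof -
    let ?Tfg = "toeplitz (\<lambda>x. f x * g x) n" and ?Tfp = "toeplitz (\<lambda>x. f x * p x) n"
    let ?TfTp = "toeplitz f n * toeplitz p n" and ?TfTg = "toeplitz f n * toeplitz g n"
    have "?Tfg - ?Tfp = toeplitz (\<lambda>x. f x * (g x - p x)) n"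
      unfolding right_diff_distrib using f g pc by (intro toeplitz_diff[symmetric] cont_periodic_mult)
    moreover have "cmod (f x * (g x - p x)) \<le> M * \<delta>" for x
      unfolding norm_mult using M p(2)[of x] by (intro mult_mono) auto
    ultimately have 1: "frobenius_norm (?Tfg - ?Tfp) \<le> M * \<delta> * sqrt (real n)"
      using frobenius_norm_toeplitz_le[of "\<lambda>x. f x * (g x - p x)" "M * \<delta>" n]
        cont_periodic_mult[OF f cont_periodic_diff[OF g pc]] by simp
    have "?TfTp - ?TfTg = toeplitz f n * toeplitz (\<lambda>x. p x - g x) n"
      unfolding toeplitz_diff[OF pc g] by (rule mult_minus_distrib_mat[symmetric]) (rule toeplitz_carrier)+
    also have "frobenius_norm \<dots> \<le> M * frobenius_norm (toeplitz (\<lambda>x. p x - g x) n)"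
      using toeplitz_mult_bounded[OF f M(2)] by (simp add: mult_bounded_def)
    also have "\<dots> \<le> M * (\<delta> * sqrt (real n))"
      using M(1) p(2) frobenius_norm_toeplitz_le[of "\<lambda>x. p x - g x" \<delta> n] cont_periodic_diff[OF pc g]
      by (intro mult_left_mono) (auto simp: norm_minus_commute)
    finally have 2: "frobenius_norm (?TfTp - ?TfTg) \<le> M * \<delta> * sqrt (real n)" by (simp add: mult.assoc)
    have "frobenius_norm (?D g n) \<le> frobenius_norm (?Tfg - ?Tfp) + frobenius_norm (?Tfp - ?TfTg)"
      using T by (intro frobenius_norm_triangle_minus[of _ n]) auto
    also have "frobenius_norm (?Tfp - ?TfTg) \<le> frobenius_norm (?D p n) + frobenius_norm (?TfTp - ?TfTg)"
      using T by (intro frobenius_norm_triangle_minus[of _ n]) auto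
    finally have "frobenius_norm (?D g n) \<le> frobenius_norm (?D p n) + 2 * (M * \<delta>) * sqrt (real n)"
      using 1 2 by (simp add: algebra_simps)
    thus ?thesis using mult_right_mono[OF M\<delta>, of "sqrt (real n)"] by simp
  qed
  thus "\<exists>Y. frob_small Y \<and>
      (\<forall>\<^sub>F n in sequentially. frobenius_norm (?D g n) \<le> frobenius_norm (Y n) + \<epsilon> * sqrt (real n))"
    using trig[OF p(1)] by (intro exI[of _ "?D p"]) simp
qed

section \<open>The algebra of asymptotically block diagonal symbols\<close>

definition pinching_defect ::
    "(nat \<Rightarrow> nat) \<Rightarrow> (nat \<Rightarrow> nat \<Rightarrow> complex mat) \<Rightarrow> (real \<Rightarrow> complex) \<Rightarrow> nat \<Rightarrow> complex mat" where
  "pinching_defect m Q f n = toeplitz f n - pinching n (m n) (Q n) (toeplitz f n)"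

definition pinching_algebra ::
    "(nat \<Rightarrow> nat) \<Rightarrow> (nat \<Rightarrow> nat \<Rightarrow> complex mat) \<Rightarrow> (real \<Rightarrow> complex) set" where
  "pinching_algebra m Q = {f \<in> cont_periodic. frob_small (pinching_defect m Q f)}"

lemma pinching_defect_carrier: "pinching_defect m Q f n \<in> carrier_mat n n"
  unfolding pinching_defect_def by (rule minus_carrier_mat) simp

text \<open>Any block diagonal approximation at the scale \<open>\<surd>n\<close> suffices, since the pinching is the best one.\<close>

lemma pinching_algebraI:
  assumes Q: "\<And>n. n \<ge> 1 \<Longrightarrow> projection_family n (m n) (Q n)"
    and f: "f \<in> cont_periodic"
    and Z: "\<And>n. n \<ge> 1 \<Longrightarrow> Z n \<in> carrier_mat n n \<and> pinching n (m n) (Q n) (Z n) = Z n"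
    and small: "frob_small (\<lambda>n. toeplitz f n - Z n)"
  shows "f \<in> pinching_algebra m Q"
proof -
  have "\<forall>\<^sub>F n in sequentially.
      frobenius_norm (pinching_defect m Q f n) \<le> 1 * frobenius_norm (toeplitz f n - Z n)"
    using eventually_ge_at_top[of 1]
  proof eventually_elim
    case (elim n)
    show ?case
      using pinching_best_approximation[OF Q[OF elim] toeplitz_carrier] Z[OF elim]
      by (simp add: pinching_defect_def)
  qed
  with small have "frob_small (pinching_defect m Q f)" by (rule frob_small_mono)
  thus ?thesis using f by (simp add: pinching_algebra_def)
qed

context
  fixes m :: "nat \<Rightarrow> nat" and Q :: "nat \<Rightarrow> nat \<Rightarrow> complex mat"
  assumes Q: "\<And>n. n \<ge> 1 \<Longrightarrow> projection_family n (m n) (Q n)"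
begin

lemma pinching_algebra_const: "(\<lambda>x. c) \<in> pinching_algebra m Q"
proof (rule pinching_algebraI[OF Q cont_periodic_const])
  show "frob_small (\<lambda>n. toeplitz (\<lambda>x. c) n - toeplitz (\<lambda>x. c) n)"
    by (simp add: frob_small_def frobenius_norm_def)
  fix n :: nat assume n: "n \<ge> 1"
  have "pinching n (m n) (Q n) (c \<cdot>\<^sub>m 1\<^sub>m n) = c \<cdot>\<^sub>m 1\<^sub>m n"
  proof (rule pinching_fixes_commutant[OF Q[OF n]])
    fix k assume "k \<in> {1..m n}"
    note D = projection_familyD(1)[OF Q[OF n] this]
    show "Q n k * (c \<cdot>\<^sub>m 1\<^sub>m n) = c \<cdot>\<^sub>m 1\<^sub>m n * Q n k"
      using D mult_smult_distrib[OF D one_carrier_mat] mult_smult_assoc_mat[OF one_carrier_mat D] by simp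
  qed simp
  thus "toeplitz (\<lambda>x. c) n \<in> carrier_mat n n
      \<and> pinching n (m n) (Q n) (toeplitz (\<lambda>x. c) n) = toeplitz (\<lambda>x. c) n"
    by (simp add: toeplitz_const)
qed

lemma pinching_algebra_diff:
  assumes "f \<in> pinching_algebra m Q" "g \<in> pinching_algebra m Q"
  shows "(\<lambda>x. f x - g x) \<in> pinching_algebra m Q"
proof -
  have c: "f \<in> cont_periodic" "g \<in> cont_periodic"
    and s: "frob_small (pinching_defect m Q f)" "frob_small (pinching_defect m Q g)"
    using assms by (auto simp: pinching_algebra_def)
  have "frob_small (pinching_defect m Q (\<lambda>x. f x - g x))"
  proof (rule frob_small_triangle[OF s, of _ 1 1])
    show "\<forall>\<^sub>F n in sequentially. frobenius_norm (pinching_defect m Q (\<lambda>x. f x - g x) n)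
        \<le> 1 * frobenius_norm (pinching_defect m Q f n) + 1 * frobenius_norm (pinching_defect m Q g n)"
      using eventually_ge_at_top[of 1]
    proof eventually_elim
      case (elim n)
      let ?E = "\<lambda>f. pinching n (m n) (Q n) (toeplitz f n)"
      have "pinching_defect m Q (\<lambda>x. f x - g x) n = (toeplitz f n - toeplitz g n) - (?E f - ?E g)"
        unfolding pinching_defect_def toeplitz_diff[OF c]
        by (simp add: pinching_minus[OF Q[OF elim] toeplitz_carrier toeplitz_carrier])
      also have "\<dots> = pinching_defect m Q f n - pinching_defect m Q g n"
        unfolding pinching_defect_def
        using carrier_matD[OF toeplitz_carrier[of f n]] carrier_matD[OF toeplitz_carrier[of g n]]
          carrier_matD[OF pinching_carrier[of n "m n" "Q n" "toeplitz f n"]]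
          carrier_matD[OF pinching_carrier[of n "m n" "Q n" "toeplitz g n"]]
        by (intro eq_matI) auto
      also have "frobenius_norm \<dots> \<le> frobenius_norm (pinching_defect m Q f n) + frobenius_norm (pinching_defect m Q g n)"
        by (rule frobenius_norm_diff_le[OF pinching_defect_carrier pinching_defect_carrier])
      finally show ?case by simp
    qed
  qed
  thus ?thesis using cont_periodic_diff[OF c] by (simp add: pinching_algebra_def)
qed

lemma pinching_algebra_cnj:
  assumes "f \<in> pinching_algebra m Q"
  shows "(\<lambda>x. cnj (f x)) \<in> pinching_algebra m Q"
proof -
  have c: "f \<in> cont_periodic" and s: "frob_small (pinching_defect m Q f)"
    using assms by (auto simp: pinching_algebra_def)
  have "frob_small (pinching_defect m Q (\<lambda>x. cnj (f x)))"
  proof (rule frob_small_mono[OF s, of _ 1])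
    show "\<forall>\<^sub>F n in sequentially. frobenius_norm (pinching_defect m Q (\<lambda>x. cnj (f x)) n)
        \<le> 1 * frobenius_norm (pinching_defect m Q f n)"
      using eventually_ge_at_top[of 1]
    proof eventually_elim
      case (elim n)
      have "pinching_defect m Q (\<lambda>x. cnj (f x)) n = mat_adjoint (pinching_defect m Q f n)"
        unfolding pinching_defect_def
        by (subst mat_adjoint_minus[of _ n])
          (simp_all add: pinching_adjoint[OF Q[OF elim] toeplitz_carrier] toeplitz_adjoint)
      thus ?case by (simp add: frobenius_norm_adjoint[OF pinching_defect_carrier])
    qed
  qed
  thus ?thesis using cont_periodic_cnj[OF c] by (simp add: pinching_algebra_def)
qed

text \<open>The difference \<open>T\<^sub>f T\<^sub>g - E(T\<^sub>f) E(T\<^sub>g)\<close> splits as \<open>T\<^sub>f (T\<^sub>g - E(T\<^sub>g)) + (T\<^sub>f - E(T\<^sub>f)) E(T\<^sub>g)\<close>. The first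
  summand is controlled by the operator bound on the left factor; in the second the bounded factor is
  on the right, so the adjoint is taken first.\<close>

lemma pinching_algebra_mult:
  assumes f: "f \<in> pinching_algebra m Q" and g: "g \<in> pinching_algebra m Q"
  shows "(\<lambda>x. f x * g x) \<in> pinching_algebra m Q"
proof -
  have c: "f \<in> cont_periodic" "g \<in> cont_periodic"
    and s: "frob_small (pinching_defect m Q f)" "frob_small (pinching_defect m Q g)"
    using assms by (auto simp: pinching_algebra_def)
  obtain M where M: "0 \<le> M" "\<And>x. cmod (f x) \<le> M" using cont_periodic_bounded[OF c(1)] by blast
  obtain N where N: "0 \<le> N" "\<And>x. cmod (g x) \<le> N" using cont_periodic_bounded[OF c(2)] by blast
  let ?E = "\<lambda>f n. pinching n (m n) (Q n) (toeplitz f n)"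
  have prod: "frob_small (\<lambda>n. toeplitz f n * toeplitz g n - ?E f n * ?E g n)"
  proof (rule frob_small_triangle[OF s(2) s(1), of _ M N])
    show "\<forall>\<^sub>F n in sequentially. frobenius_norm (toeplitz f n * toeplitz g n - ?E f n * ?E g n)
        \<le> M * frobenius_norm (pinching_defect m Q g n) + N * frobenius_norm (pinching_defect m Q f n)"
      using eventually_ge_at_top[of 1]
    proof eventually_elim
      case (elim n)
      let ?Tf = "toeplitz f n" and ?Tg = "toeplitz g n" and ?Ef = "?E f n" and ?Eg = "?E g n"
      have mc: "A * B \<in> carrier_mat n n" if "A \<in> carrier_mat n n" "B \<in> carrier_mat n n" for A B :: "complex mat"
        using that by (rule mult_carrier_mat)
      have "?Tf * ?Tg - ?Tf * ?Eg = ?Tf * pinching_defect m Q g n"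
        unfolding pinching_defect_def by (rule mult_minus_distrib_mat[symmetric, of _ n n _ n]) simp_all
      also have "frobenius_norm \<dots> \<le> M * frobenius_norm (pinching_defect m Q g n)"
        using toeplitz_mult_bounded[OF c(1) M(2), of n] pinching_defect_carrier
        by (simp add: mult_bounded_def)
      finally have 1: "frobenius_norm (?Tf * ?Tg - ?Tf * ?Eg) \<le> M * frobenius_norm (pinching_defect m Q g n)" .
      have "mult_bounded n (toeplitz (\<lambda>x. cnj (g x)) n) N"
        using N(2) by (intro toeplitz_mult_bounded cont_periodic_cnj c(2)) simp
      hence bd: "mult_bounded n (mat_adjoint ?Eg) N"
        unfolding pinching_adjoint[OF Q[OF elim] toeplitz_carrier] toeplitz_adjoint
        by (rule mult_bounded_pinching[OF Q[OF elim] _ N(1)])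
      have "?Tf * ?Eg - ?Ef * ?Eg = pinching_defect m Q f n * ?Eg"
        unfolding pinching_defect_def by (rule minus_mult_distrib_mat[symmetric, of _ n n _ _ n]) simp_all
      also have "frobenius_norm \<dots> = frobenius_norm (mat_adjoint ?Eg * mat_adjoint (pinching_defect m Q f n))"
        by (subst mat_adjoint_mult[symmetric, of _ n])
          (simp_all add: pinching_defect_carrier frobenius_norm_adjoint[of _ n] mc)
      also have "\<dots> \<le> N * frobenius_norm (mat_adjoint (pinching_defect m Q f n))"
        using bd mat_adjoint_carrier[OF pinching_defect_carrier] by (simp add: mult_bounded_def)
      also have "\<dots> = N * frobenius_norm (pinching_defect m Q f n)"
        by (simp add: frobenius_norm_adjoint[OF pinching_defect_carrier])
      finally have 2: "frobenius_norm (?Tf * ?Eg - ?Ef * ?Eg) \<le> N * frobenius_norm (pinching_defect m Q f n)" .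
      have "frobenius_norm (?Tf * ?Tg - ?Ef * ?Eg)
          \<le> frobenius_norm (?Tf * ?Tg - ?Tf * ?Eg) + frobenius_norm (?Tf * ?Eg - ?Ef * ?Eg)"
        by (rule frobenius_norm_triangle_minus[of _ n]) (simp_all add: mc)
      with 1 2 show ?case by linarith
    qed
  qed
  show ?thesis
  proof (rule pinching_algebraI[OF Q cont_periodic_mult[OF c]])
    fix n :: nat assume n: "n \<ge> 1"
    show "?E f n * ?E g n \<in> carrier_mat n n \<and>
        pinching n (m n) (Q n) (?E f n * ?E g n) = ?E f n * ?E g n"
      using pinching_mult_pinching[OF Q[OF n] toeplitz_carrier toeplitz_carrier]
      by (auto intro: mult_carrier_mat[of _ n n])
  next
    show "frob_small (\<lambda>n. toeplitz (\<lambda>x. f x * g x) n - ?E f n * ?E g n)"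
    proof (rule frob_small_triangle[OF toeplitz_mult_asymptotic[OF c] prod, of _ 1 1])
      have "frobenius_norm (toeplitz (\<lambda>x. f x * g x) n - ?E f n * ?E g n)
          \<le> frobenius_norm (toeplitz (\<lambda>x. f x * g x) n - toeplitz f n * toeplitz g n)
            + frobenius_norm (toeplitz f n * toeplitz g n - ?E f n * ?E g n)" for n
        by (rule frobenius_norm_triangle_minus[of _ n]) (auto intro: mult_carrier_mat[of _ n n])
      thus "\<forall>\<^sub>F n in sequentially. frobenius_norm (toeplitz (\<lambda>x. f x * g x) n - ?E f n * ?E g n)
          \<le> 1 * frobenius_norm (toeplitz (\<lambda>x. f x * g x) n - toeplitz f n * toeplitz g n)
            + 1 * frobenius_norm (toeplitz f n * toeplitz g n - ?E f n * ?E g n)" by simp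
    qed
  qed
qed

text \<open>Constants and products give the scalar multiple \<open>-g\<close>, so the sum reduces to a difference.\<close>

lemma pinching_algebra_add:
  assumes f: "f \<in> pinching_algebra m Q" and g: "g \<in> pinching_algebra m Q"
  shows "(\<lambda>x. f x + g x) \<in> pinching_algebra m Q"
proof -
  have "(\<lambda>x. f x - (- 1) * g x) \<in> pinching_algebra m Q"
    by (intro pinching_algebra_diff pinching_algebra_mult pinching_algebra_const f g)
  thus ?thesis by simp
qed

text \<open>If \<open>F\<^sub>k\<close> is uniformly \<open>\<epsilon>\<close>-close to \<open>f\<close>, then \<open>E\<^sub>n(A\<^sub>n(F\<^sub>k))\<close> is a competitor of \<open>E\<^sub>n(A\<^sub>n(f))\<close> that is within
  \<open>\<epsilon> \<surd>n\<close> plus the defect of \<open>F\<^sub>k\<close>.\<close>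

lemma pinching_algebra_closed:
  assumes F: "\<And>k. F k \<in> pinching_algebra m Q" and lim: "uniform_limit UNIV F f sequentially"
  shows "f \<in> pinching_algebra m Q"
proof -
  have Fc: "F k \<in> cont_periodic" and Fs: "frob_small (pinching_defect m Q (F k))" for k
    using F[of k] by (auto simp: pinching_algebra_def)
  have "continuous_on UNIV f"
    using Fc by (intro uniform_limit_theorem[OF _ lim]) (auto simp: cont_periodic_def)
  moreover have "f (x + 2 * pi) = f x" for x
  proof (rule LIMSEQ_unique)
    have pointwise: "(\<lambda>k. F k y) \<longlonglongrightarrow> f y" for y by (rule tendsto_uniform_limitI[OF lim]) simp
    show "(\<lambda>k. F k x) \<longlonglongrightarrow> f x" by (rule pointwise)
    show "(\<lambda>k. F k x) \<longlonglongrightarrow> f (x + 2 * pi)"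
      using pointwise[of "x + 2 * pi"] by (simp add: cont_periodicD(2)[OF Fc])
  qed
  ultimately have fc: "f \<in> cont_periodic" by (simp add: cont_periodic_def)
  have "frob_small (pinching_defect m Q f)"
  proof (rule frob_small_approx)
    fix \<epsilon> :: real assume "\<epsilon> > 0"
    with lim have "\<forall>\<^sub>F k in sequentially. \<forall>x\<in>UNIV. dist (F k x) (f x) < \<epsilon>"
      by (simp add: uniform_limit_iff)
    then obtain k where "\<forall>x. dist (F k x) (f x) < \<epsilon>" by (auto simp: eventually_sequentially)
    hence k: "cmod (f x - F k x) \<le> \<epsilon>" for x by (simp add: dist_norm norm_minus_commute less_imp_le)
    have "\<forall>\<^sub>F n in sequentially. frobenius_norm (pinching_defect m Q f n)
        \<le> frobenius_norm (pinching_defect m Q (F k) n) + \<epsilon> * sqrt (real n)"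
      using eventually_ge_at_top[of 1]
    proof eventually_elim
      case (elim n)
      let ?E = "pinching n (m n) (Q n) (toeplitz (F k) n)"
      have "frobenius_norm (pinching_defect m Q f n) \<le> frobenius_norm (toeplitz f n - ?E)"
        unfolding pinching_defect_def
        using pinching_idem[OF Q[OF elim] toeplitz_carrier]
        by (intro pinching_best_approximation[OF Q[OF elim]]) auto
      also have "\<dots> \<le> frobenius_norm (toeplitz f n - toeplitz (F k) n)
          + frobenius_norm (pinching_defect m Q (F k) n)"
        unfolding pinching_defect_def by (rule frobenius_norm_triangle_minus[of _ n]) auto
      also have "frobenius_norm (toeplitz f n - toeplitz (F k) n) \<le> \<epsilon> * sqrt (real n)"
        unfolding toeplitz_diff[OF fc Fc, symmetric]
        by (rule frobenius_norm_toeplitz_le[OF cont_periodic_diff[OF fc Fc] k])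
      finally show ?case by simp
    qed
    thus "\<exists>Y. frob_small Y \<and> (\<forall>\<^sub>F n in sequentially.
        frobenius_norm (pinching_defect m Q f n) \<le> frobenius_norm (Y n) + \<epsilon> * sqrt (real n))"
      using Fs by blast
  qed
  thus ?thesis using fc by (simp add: pinching_algebra_def)
qed

lemma cstar_subalgebra_pinching_algebra: "cstar_subalgebra (pinching_algebra m Q)"
  unfolding cstar_subalgebra_def
proof (intro conjI ballI allI impI)
  show "pinching_algebra m Q \<subseteq> cont_periodic" by (auto simp: pinching_algebra_def)
  show "f \<in> pinching_algebra m Q"
    if "(\<forall>k. F k \<in> pinching_algebra m Q) \<and> uniform_limit UNIV F f sequentially" for F f
    using that by (intro pinching_algebra_closed[of F f]) auto
qed (simp_all add: pinching_algebra_const pinching_algebra_add pinching_algebra_mult pinching_algebra_cnj)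

lemma weak_cluster_iff_pinching_algebra:
  assumes f: "f \<in> cont_periodic"
    and E: "\<And>n. n \<ge> 1 \<Longrightarrow> E n = pinching n (m n) (Q n) (toeplitz f n)"
  shows "weak_cluster E (toeplitz f) \<longleftrightarrow> f \<in> pinching_algebra m Q"
proof -
  have "\<forall>\<^sub>F n in sequentially. frobenius_norm (E n - toeplitz f n) = frobenius_norm (pinching_defect m Q f n)"
    using eventually_ge_at_top[of 1]
  proof eventually_elim
    case (elim n)
    show ?case unfolding E[OF elim] pinching_defect_def by (rule frobenius_norm_minus_commute[of _ n]) auto
  qed
  hence "frob_small (\<lambda>n. E n - toeplitz f n) \<longleftrightarrow> frob_small (pinching_defect m Q f)"
    unfolding frob_small_def by (rule landau_o.small.in_cong)
  moreover have "weak_cluster E (toeplitz f) \<longleftrightarrow> frob_small (\<lambda>n. E n - toeplitz f n)"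
  proof
    show "weak_cluster E (toeplitz f)" if "frob_small (\<lambda>n. E n - toeplitz f n)"
      using that by (rule frob_small_imp_weak_cluster[rotated]) (rule minus_carrier_mat, simp)
    obtain M where M: "0 \<le> M" "\<And>x. cmod (f x) \<le> M" using cont_periodic_bounded[OF f] by blast
    have "mult_bounded n (E n - toeplitz f n) (M + M)" if n: "n \<ge> 1" for n
      unfolding E[OF n]
      by (intro mult_bounded_minus mult_bounded_pinching[OF Q[OF n]] toeplitz_mult_bounded f M)
    thus "frob_small (\<lambda>n. E n - toeplitz f n)" if "weak_cluster E (toeplitz f)"
      using that M(1) by (intro weak_cluster_imp_frob_small[of _ _ "M + M"]) auto
  qed
  ultimately show ?thesis using f by (simp add: pinching_algebra_def)
qed

end

theorem theorem4p7:
  fixes U :: "nat \<Rightarrow> complex mat"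
    and m :: "nat \<Rightarrow> nat"
    and P :: "nat \<Rightarrow> nat \<Rightarrow> complex mat"
    and G :: "(real \<Rightarrow> complex) set"
    and f :: "real \<Rightarrow> complex"
  assumes "\<And>n. n \<ge> 1 \<Longrightarrow> unitary_mat n (U n)"
    and "\<And>n. n \<ge> 1 \<Longrightarrow> projection_family n (m n) (P n)"
    and "finite G"
    and "G \<subseteq> cont_periodic"
    and "\<And>g x. g \<in> G \<Longrightarrow> g x \<in> \<real>"
    and "\<And>h. h \<in> G \<union> (\<lambda>g x. (g x)\<^sup>2) ` G \<Longrightarrow>
           weak_cluster (\<lambda>n. precond n (m n) (P n) (U n) (toeplitz h n)) (toeplitz h)"
    and "f \<in> cstar_generated G"
  shows "weak_cluster (\<lambda>n. precond n (m n) (P n) (U n) (toeplitz f n)) (toeplitz f)"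
proof -
  define Q where "Q = (\<lambda>n k. U n * P n k * mat_adjoint (U n))"
  have Q: "projection_family n (m n) (Q n)" if "n \<ge> 1" for n
    unfolding Q_def by (rule precond_eq_pinching(1)[OF assms(1,2)[OF that]])
  have E: "precond n (m n) (P n) (U n) (toeplitz h n) = pinching n (m n) (Q n) (toeplitz h n)"
    if "n \<ge> 1" for n h
    unfolding Q_def by (rule precond_eq_pinching(2)[OF assms(1,2)[OF that] toeplitz_carrier])
  note iff = weak_cluster_iff_pinching_algebra[OF Q]
  have "G \<subseteq> pinching_algebra m Q"
  proof
    fix g assume g: "g \<in> G"
    hence "weak_cluster (\<lambda>n. precond n (m n) (P n) (U n) (toeplitz g n)) (toeplitz g)"
      by (intro assms(6)) simp
    thus "g \<in> pinching_algebra m Q" using iff[OF _ _ E] g assms(4) by blast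
  qed
  hence "f \<in> pinching_algebra m Q"
    using assms(7) cstar_subalgebra_pinching_algebra[OF Q] unfolding cstar_generated_def by blast
  moreover from this have "f \<in> cont_periodic" by (simp add: pinching_algebra_def)
  ultimately show ?thesis using iff[OF _ _ E] by blast
qed

end
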